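(* Let $\lambda\in(0,1]$ and let $(\widetilde M_\lambda,\widetilde\alpha_\lambda)$ be the natural reversible extension of $([0,1],\alpha_\lambda)$ associated with the set $Y$, where $Y=[\lambda,1]$ if $\lambda<1$ and $Y=\emptyset$ if $\lambda=1$. Then the algebra $\mathcal B_\lambda=C^*\big(\bigcup_{n\in\mathbb N}U_\lambda^{*n}\mathcal A U_\lambda^n\big)$ may be identified (by a $*$-isomorphism) with $C(\widetilde M_\lambda)$ in such a way that the partial automorphism $\delta_\lambda:\mathcal B_\lambda\to\mathcal B_\lambda$, $\delta_\lambda(b)=U_\lambda bU_\lambda^*$, becomes the operator of composition with the homeomorphism $\widetilde\alpha_\lambda:\widetilde M_\lambda\to\widetilde\alpha_\lambda(\widetilde M_\lambda)$: $$\mathcal B_\lambda=C(\widetilde M_\lambda),\qquad \delta_\lambda(a)=a\circ\widetilde\alpha_\lambda,\quad a\in\mathcal B_\lambda .$$ In particular, the operator $U_\lambda$ generates on $\widetilde M_\lambda$ the partial homeomorphism $\widetilde\alpha_\lambda$.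
   Context: $\mathbb N=\{0,1,2,\dots\}$; $\{t\}$ is the fractional part of $t\in\mathbb R$. For $\lambda\in(0,1]$, $\alpha_\lambda:[0,1]\to[0,1]$, $\alpha_\lambda(x)=4\lambda x(1-x)$. $\mathcal A\subset L(L^2(\mathbb R))$ is the $C^*$-algebra of operators of multiplication by functions $a$ on $\mathbb R$ with $a(t+1)=a(t)$, $a|_{[0,1)}$ continuous, and $\lim_{t\to1^-}a(t)$ existing; $\mathcal A\cong C([0,1])$. Define $\gamma_\lambda:\mathbb R\to\mathbb R$ by $\gamma_\lambda(t)=4\lambda\{t\}(1-\{t\})+2k$ for $t\in[k,k+\frac12]$ and $\gamma_\lambda(t)=4\lambda\{t\}(1-\{t\})+2k+1$ for $t\in(k+\frac12,k+1)$, $k\in\mathbb Z$; and $(U_\lambda f)(t)=\sqrt{|\gamma_\lambda'(t)|}\,f(\gamma_\lambda(t))$, $f\in L^2(\mathbb R)$ (a coisometry). For a commutative unital $C^*$-algebra $\mathcal C$ with $U_\lambda\mathcal CU_\lambda^*\subset\mathcal C$ and $U_\lambda^*U_\lambda$ commuting with $\mathcal C$, the map generated by $U_\lambda$ on the spectrum of $\mathcal C$ is $x\mapsto x(U_\lambda\,\cdot\,U_\lambda^* )$. For a continuous map $\alpha:M\to M$ of a compact Hausdorff space and closed $Y\supset M\setminus\alpha(M)$, the natural reversible extension of $(M,\alpha)$ associated with $Y$ is $(\widetilde M,\widetilde\alpha)$, where $\widetilde M=\bigcup_{N=0}^\infty M_N\cup M_\infty\subset\prod_{n\in\mathbb N}(M\cup\{\mathbf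 0\})$ (product topology, $\mathbf 0$ an added isolated point, different from all points of $M$), $M_N=\{(x_0,\dots,x_N,\mathbf 0,\mathbf 0,\dots): x_n\in M,\ \alpha(x_n)=x_{n-1}\ (1\le n\le N),\ x_N\in Y\}$, $M_\infty=\{(x_0,x_1,\dots): x_n\in M,\ \alpha(x_n)=x_{n-1},\ n\ge1\}$, and $\widetilde\alpha(x_0,x_1,\dots)=(\alpha(x_0),x_0,x_1,\dots)$. *)

theory Defs
  imports "HOL-Analysis.Analysis"
begin

section \<open>The Hilbert space of square-integrable functions on the real line\<close>

definition square_integrable :: "(real \<Rightarrow> complex) \<Rightarrow> bool" where
  "square_integrable f \<longleftrightarrow>
     f \<in> borel_measurable lborel \<and> integrable lborel (\<lambda>t. (cmod (f t))\<^sup>2)"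

definition L2_rel :: "(real \<Rightarrow> complex) \<Rightarrow> (real \<Rightarrow> complex) \<Rightarrow> bool" where
  "L2_rel f g \<longleftrightarrow> square_integrable f \<and> square_integrable g \<and> (AE t in lborel. f t = g t)"

lemma measurable_cnj [measurable]: "cnj \<in> borel_measurable borel"
  by (intro borel_measurable_continuous_onI continuous_intros)

lemma L2_relI:
  assumes "square_integrable f" "\<And>t. f t = g t" shows "L2_rel f g"
proof -
  have "f = g" using assms(2) by (rule ext)
  then show ?thesis using assms(1) by (simp add: L2_rel_def)
qed

lemma square_integrable_zero: "square_integrable (\<lambda>_. 0)"
  by (simp add: square_integrable_def)

lemma square_integrable_scale:
  assumes "square_integrable f" shows "square_integrable (\<lambda>t. c * f t)"
  using assms by (auto simp: square_integrable_def norm_mult power_mult_distrib)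

lemma square_integrable_add:
  assumes "square_integrable f" "square_integrable g"
  shows "square_integrable (\<lambda>t. f t + g t)"
proof -
  have [measurable]: "f \<in> borel_measurable lborel" "g \<in> borel_measurable lborel"
    using assms by (auto simp: square_integrable_def)
  have "integrable lborel (\<lambda>t. (cmod (f t + g t))\<^sup>2)"
  proof (rule Bochner_Integration.integrable_bound)
    show "integrable lborel (\<lambda>t. 2 * (cmod (f t))\<^sup>2 + 2 * (cmod (g t))\<^sup>2)"
      using assms by (auto simp: square_integrable_def)
    have "(cmod (f t + g t))\<^sup>2 \<le> 2 * (cmod (f t))\<^sup>2 + 2 * (cmod (g t))\<^sup>2" for t
    proof -
      have "(cmod (f t + g t))\<^sup>2 \<le> (cmod (f t) + cmod (g t))\<^sup>2"
        by (intro power_mono norm_triangle_ineq) auto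
      also have "\<dots> \<le> 2 * (cmod (f t))\<^sup>2 + 2 * (cmod (g t))\<^sup>2"
        using sum_squares_bound[of "cmod (f t)" "cmod (g t)"] by (simp add: power2_sum)
      finally show ?thesis .
    qed
    then show "AE t in lborel. norm ((cmod (f t + g t))\<^sup>2)
        \<le> norm (2 * (cmod (f t))\<^sup>2 + 2 * (cmod (g t))\<^sup>2)"
      by auto
  qed measurable
  then show ?thesis by (simp add: square_integrable_def)
qed

lemma square_integrable_product:
  assumes "square_integrable f" "square_integrable g"
  shows "integrable lborel (\<lambda>t. f t * cnj (g t))"
proof -
  have [measurable]: "f \<in> borel_measurable lborel" "g \<in> borel_measurable lborel"
    using assms by (auto simp: square_integrable_def)
  show ?thesis
  proof (rule Bochner_Integration.integrable_bound)
    show "integrable lborel (\<lambda>t. (cmod (f t))\<^sup>2 + (cmod (g t))\<^sup>2)"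
      using assms by (auto simp: square_integrable_def)
    have "cmod (f t * cnj (g t)) \<le> (cmod (f t))\<^sup>2 + (cmod (g t))\<^sup>2" for t
    proof -
      have "2 * (cmod (f t) * cmod (g t)) \<le> (cmod (f t))\<^sup>2 + (cmod (g t))\<^sup>2"
        using sum_squares_bound[of "cmod (f t)" "cmod (g t)"] by (simp add: mult.assoc)
      moreover have "0 \<le> cmod (f t) * cmod (g t)" by simp
      ultimately show ?thesis unfolding norm_mult complex_mod_cnj by linarith
    qed
    then show "AE t in lborel. norm (f t * cnj (g t))
        \<le> norm ((cmod (f t))\<^sup>2 + (cmod (g t))\<^sup>2)"
      by auto
  qed measurable
qed

quotient_type L2 = "real \<Rightarrow> complex" / partial: L2_rel
proof (rule part_equivpI)
  show "\<exists>f. L2_rel f f" using square_integrable_zero by (auto simp: L2_rel_def)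
  show "symp L2_rel" by (auto simp: symp_def L2_rel_def)
  show "transp L2_rel" unfolding transp_def L2_rel_def
  proof (intro allI impI conjI; elim conjE)
    fix f g h :: "real \<Rightarrow> complex"
    assume "AE t in lborel. f t = g t" "AE t in lborel. g t = h t"
    then show "AE t in lborel. f t = h t" by eventually_elim simp
  qed
qed

lift_definition cscale :: "complex \<Rightarrow> L2 \<Rightarrow> L2" is "\<lambda>c f t. c * f t"
  by (auto simp: L2_rel_def square_integrable_scale)

lift_definition cinner :: "L2 \<Rightarrow> L2 \<Rightarrow> complex" is
  "\<lambda>f g. integral\<^sup>L lborel (\<lambda>t. f t * cnj (g t))"
proof (rule integral_cong_AE)
  fix f f' g g' :: "real \<Rightarrow> complex" assume *: "L2_rel f f'" "L2_rel g g'"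
  then have [measurable]: "f \<in> borel_measurable lborel" "f' \<in> borel_measurable lborel"
      "g \<in> borel_measurable lborel" "g' \<in> borel_measurable lborel"
    by (auto simp: L2_rel_def square_integrable_def)
  show "(\<lambda>t. f t * cnj (g t)) \<in> borel_measurable lborel"
    "(\<lambda>t. f' t * cnj (g' t)) \<in> borel_measurable lborel" by measurable
  show "AE t in lborel. f t * cnj (g t) = f' t * cnj (g' t)"
    using * by (auto simp: L2_rel_def)
qed

instantiation L2 :: real_vector
begin

lift_definition zero_L2 :: L2 is "\<lambda>_. 0"
  by (simp add: L2_rel_def square_integrable_zero)

lift_definition plus_L2 :: "L2 \<Rightarrow> L2 \<Rightarrow> L2" is "\<lambda>f g t. f t + g t"
  by (auto simp: L2_rel_def square_integrable_add)

lift_definition scaleR_L2 :: "real \<Rightarrow> L2 \<Rightarrow> L2" is "\<lambda>r f t. complex_of_real r * f t"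
  by (auto simp: L2_rel_def square_integrable_scale)

definition "uminus_L2 f = scaleR (-1) (f :: L2)"

definition "minus_L2 f g = f + - (g :: L2)"

instance
proof
  fix f g h :: L2 and r s :: real
  note sq = square_integrable_add square_integrable_scale square_integrable_zero
  show "f + g + h = f + (g + h)"
    by transfer (rule L2_relI, auto simp: L2_rel_def algebra_simps intro!: sq)
  show "f + g = g + f"
    by transfer (rule L2_relI, auto simp: L2_rel_def intro!: sq)
  show "0 + f = f"
    by transfer (rule L2_relI, auto simp: L2_rel_def)
  show "- f + f = 0" unfolding uminus_L2_def
    by transfer (rule L2_relI, auto simp: L2_rel_def square_integrable_zero)
  show "f - g = f + - g" by (simp add: minus_L2_def)
  show "r *\<^sub>R (f + g) = r *\<^sub>R f + r *\<^sub>R g"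
  proof transfer
    fix r f g assume "L2_rel f f" "L2_rel g g"
    then show "L2_rel (\<lambda>t. complex_of_real r * (f t + g t))
        (\<lambda>t. complex_of_real r * f t + complex_of_real r * g t)"
      by (intro L2_relI sq distrib_left) (auto simp: L2_rel_def)
  qed
  show "(r + s) *\<^sub>R f = r *\<^sub>R f + s *\<^sub>R f"
  proof transfer
    fix r s f assume "L2_rel f f"
    then show "L2_rel (\<lambda>t. complex_of_real (r + s) * f t)
        (\<lambda>t. complex_of_real r * f t + complex_of_real s * f t)"
      by (intro L2_relI sq) (auto simp: L2_rel_def algebra_simps)
  qed
  show "r *\<^sub>R s *\<^sub>R f = (r * s) *\<^sub>R f"
    by transfer (rule L2_relI, auto simp: L2_rel_def intro!: sq)
  show "1 *\<^sub>R f = f"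
    by transfer (auto simp: L2_rel_def)
qed

end

instantiation L2 :: real_inner
begin

definition "inner_L2 f g = Re (cinner f g)"
definition "norm_L2 f = sqrt (inner f (f :: L2))"
definition "sgn_L2 f = scaleR (inverse (norm f)) (f :: L2)"
definition "dist_L2 f g = norm (f - (g :: L2))"
definition "uniformity_L2 = (INF e\<in>{0<..}. principal {(f :: L2, g). dist f g < e})"
definition "open_L2 (S :: L2 set) \<longleftrightarrow>
  (\<forall>f\<in>S. eventually (\<lambda>(f', g). f' = f \<longrightarrow> g \<in> S) uniformity)"

instance
proof
  fix f g h :: L2 and r :: real
  show "dist f g = norm (f - g)" by (simp add: dist_L2_def)
  show "sgn f = f /\<^sub>R norm f" by (simp add: sgn_L2_def)
  show "uniformity = (INF e\<in>{0<..}. principal {(f :: L2, g). dist f g < e})"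
    by (rule uniformity_L2_def)
  show "open S \<longleftrightarrow> (\<forall>f\<in>S. \<forall>\<^sub>F (f', g) in uniformity. f' = f \<longrightarrow> g \<in> S)" for S :: "L2 set"
    by (rule open_L2_def)
  show "norm f = sqrt (f \<bullet> f)" by (rule norm_L2_def)
  have "cinner f g = cnj (cinner g f)"
  proof transfer
    fix u v :: "real \<Rightarrow> complex"
    have "(\<lambda>t. u t * cnj (v t)) = (\<lambda>t. cnj (v t * cnj (u t)))" by (simp add: mult.commute)
    then show "integral\<^sup>L lborel (\<lambda>t. u t * cnj (v t)) = cnj (integral\<^sup>L lborel (\<lambda>t. v t * cnj (u t)))"
      by (simp only: Bochner_Integration.integral_cnj)
  qed
  then show "f \<bullet> g = g \<bullet> f" by (simp add: inner_L2_def)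
  have "cinner (f + g) h = cinner f h + cinner g h"
    by transfer (simp add: L2_rel_def distrib_right square_integrable_product)
  then show "(f + g) \<bullet> h = f \<bullet> h + g \<bullet> h" by (simp add: inner_L2_def)
  have "cinner (r *\<^sub>R f) g = complex_of_real r * cinner f g"
    by transfer (simp add: mult.assoc)
  then show "r *\<^sub>R f \<bullet> g = r * (f \<bullet> g)" by (simp add: inner_L2_def)
  have sq: "Re (integral\<^sup>L lborel (\<lambda>t. u t * cnj (u t))) = integral\<^sup>L lborel (\<lambda>t. (cmod (u t))\<^sup>2)"
    if "square_integrable u" for u :: "real \<Rightarrow> complex"
    unfolding complex_norm_square[symmetric] of_real_power[symmetric]
    by (simp only: integral_complex_of_real Re_complex_of_real)
  show "0 \<le> f \<bullet> f" unfolding inner_L2_def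
    by transfer (simp add: L2_rel_def sq)
  show "f \<bullet> f = 0 \<longleftrightarrow> f = 0" unfolding inner_L2_def
  proof transfer
    fix u assume "L2_rel u u"
    then have u: "square_integrable u" by (simp add: L2_rel_def)
    have "integral\<^sup>L lborel (\<lambda>t. (cmod (u t))\<^sup>2) = 0 \<longleftrightarrow> (AE t in lborel. (cmod (u t))\<^sup>2 = 0)"
      by (rule integral_nonneg_eq_0_iff_AE) (use u in \<open>auto simp: square_integrable_def\<close>)
    then show "Re (integral\<^sup>L lborel (\<lambda>t. u t * cnj (u t))) = 0 \<longleftrightarrow> L2_rel u (\<lambda>_. 0)"
      using u by (simp add: sq L2_rel_def square_integrable_zero)
  qed
qed

end


section \<open>Bounded operators and C*-algebras of operators\<close>

type_synonym L2_op = "L2 \<Rightarrow> L2"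

definition bounded_ops :: "L2_op set" where
  "bounded_ops = {T. bounded_linear T \<and> (\<forall>c f. T (cscale c f) = cscale c (T f))}"

definition adj :: "L2_op \<Rightarrow> L2_op" where
  "adj T = (THE S. \<forall>f g. cinner (T f) g = cinner f (S g))"

definition cstar_subalgebra :: "L2_op set \<Rightarrow> bool" where
  "cstar_subalgebra B \<longleftrightarrow>
     B \<subseteq> bounded_ops \<and>
     (\<lambda>_. 0) \<in> B \<and>
     (\<forall>S\<in>B. \<forall>T\<in>B. (\<lambda>f. S f + T f) \<in> B) \<and>
     (\<forall>c. \<forall>T\<in>B. (\<lambda>f. cscale c (T f)) \<in> B) \<and>
     (\<forall>S\<in>B. \<forall>T\<in>B. S \<circ> T \<in> B) \<and>
     (\<forall>T\<in>B. adj T \<in> B) \<and>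
     (\<forall>X. \<forall>T\<in>bounded_ops. (\<forall>n. X n \<in> B) \<longrightarrow>
        (\<lambda>n. onorm (\<lambda>f. X n f - T f)) \<longlonglongrightarrow> 0 \<longrightarrow> T \<in> B)"

definition Cstar :: "L2_op set \<Rightarrow> L2_op set" where
  "Cstar S = \<Inter>{B. cstar_subalgebra B \<and> S \<subseteq> B}"

definition op_star_hom :: "L2_op set \<Rightarrow> L2_op set \<Rightarrow> (L2_op \<Rightarrow> L2_op) \<Rightarrow> bool" where
  "op_star_hom B C \<phi> \<longleftrightarrow>
     \<phi> ` B \<subseteq> C \<and>
     (\<forall>a\<in>B. \<forall>b\<in>B. \<phi> (\<lambda>f. a f + b f) = (\<lambda>f. \<phi> a f + \<phi> b f)) \<and>
     (\<forall>c. \<forall>a\<in>B. \<phi> (\<lambda>f. cscale c (a f)) = (\<lambda>f. cscale c (\<phi> a f))) \<and>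
     (\<forall>a\<in>B. \<forall>b\<in>B. \<phi> (a \<circ> b) = \<phi> a \<circ> \<phi> b) \<and>
     (\<forall>a\<in>B. \<phi> (adj a) = adj (\<phi> a))"

definition closed_ideal :: "L2_op set \<Rightarrow> L2_op set \<Rightarrow> bool" where
  "closed_ideal I B \<longleftrightarrow>
     I \<subseteq> B \<and> cstar_subalgebra I \<and> (\<forall>b\<in>B. \<forall>c\<in>I. b \<circ> c \<in> I \<and> c \<circ> b \<in> I)"

text \<open>A partial automorphism, regarded as a map defined on all of \<open>B\<close>: a *-endomorphism whose range
  \<open>J\<close> is a closed ideal and which restricts to an isomorphism of a closed ideal \<open>I\<close> onto \<open>J\<close>.  Then
  \<open>B\<close> is the direct sum of \<open>I\<close> and the kernel.\<close>

definition partial_automorphism :: "L2_op set \<Rightarrow> (L2_op \<Rightarrow> L2_op) \<Rightarrow> bool" where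
  "partial_automorphism B \<delta> \<longleftrightarrow>
     op_star_hom B B \<delta> \<and>
     (\<exists>I J. closed_ideal I B \<and> closed_ideal J B \<and> \<delta> ` B = J \<and> bij_betw \<delta> I J)"


section \<open>Continuous functions, the spectrum, and the map generated by an operator\<close>

text \<open>Functions are normalised by \<open>extensional\<close>, since the space is the carrier of a topology
  and not a type.\<close>

definition cfunctions :: "'a topology \<Rightarrow> ('a \<Rightarrow> complex) set" where
  "cfunctions X = {u \<in> extensional (topspace X). continuous_map X euclidean u}"

definition star_iso_cfunctions ::
    "L2_op set \<Rightarrow> 'a topology \<Rightarrow> (L2_op \<Rightarrow> 'a \<Rightarrow> complex) \<Rightarrow> bool" where
  "star_iso_cfunctions B X \<Phi> \<longleftrightarrow>
     bij_betw \<Phi> B (cfunctions X) \<and>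
     (\<forall>a\<in>B. \<forall>b\<in>B. \<forall>x\<in>topspace X. \<Phi> (\<lambda>f. a f + b f) x = \<Phi> a x + \<Phi> b x) \<and>
     (\<forall>c. \<forall>a\<in>B. \<forall>x\<in>topspace X. \<Phi> (\<lambda>f. cscale c (a f)) x = c * \<Phi> a x) \<and>
     (\<forall>a\<in>B. \<forall>b\<in>B. \<forall>x\<in>topspace X. \<Phi> (a \<circ> b) x = \<Phi> a x * \<Phi> b x) \<and>
     (\<forall>a\<in>B. \<forall>x\<in>topspace X. \<Phi> (adj a) x = cnj (\<Phi> a x))"

definition character :: "L2_op set \<Rightarrow> (L2_op \<Rightarrow> complex) \<Rightarrow> bool" where
  "character C \<phi> \<longleftrightarrow>
     \<phi> \<in> extensional C \<and>
     (\<forall>a\<in>C. \<forall>b\<in>C. \<phi> (\<lambda>f. a f + b f) = \<phi> a + \<phi> b) \<and>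
     (\<forall>c. \<forall>a\<in>C. \<phi> (\<lambda>f. cscale c (a f)) = c * \<phi> a) \<and>
     (\<forall>a\<in>C. \<forall>b\<in>C. \<phi> (a \<circ> b) = \<phi> a * \<phi> b) \<and>
     (\<exists>a\<in>C. \<phi> a \<noteq> 0)"

definition spectrum :: "L2_op set \<Rightarrow> (L2_op \<Rightarrow> complex) topology" where
  "spectrum C = subtopology (product_topology (\<lambda>_. euclidean) C) {\<phi>. character C \<phi>}"

definition conj_by :: "L2_op \<Rightarrow> L2_op \<Rightarrow> L2_op" where
  "conj_by U b = U \<circ> b \<circ> adj U"

definition generates_on :: "L2_op \<Rightarrow> L2_op set \<Rightarrow> bool" where
  "generates_on U C \<longleftrightarrow>
     cstar_subalgebra C \<and> id \<in> C \<and> (\<forall>a\<in>C. \<forall>b\<in>C. a \<circ> b = b \<circ> a) \<and>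
     conj_by U ` C \<subseteq> C \<and>
     (\<forall>a\<in>C. (adj U \<circ> U) \<circ> a = a \<circ> (adj U \<circ> U))"

definition eval_at :: "L2_op set \<Rightarrow> (L2_op \<Rightarrow> 'a \<Rightarrow> complex) \<Rightarrow> 'a \<Rightarrow> (L2_op \<Rightarrow> complex)" where
  "eval_at B \<Phi> x = restrict (\<lambda>b. \<Phi> b x) B"

definition generated_map ::
    "L2_op \<Rightarrow> L2_op set \<Rightarrow> (L2_op \<Rightarrow> complex) \<Rightarrow> (L2_op \<Rightarrow> complex)" where
  "generated_map U C \<phi> = restrict (\<lambda>b. \<phi> (conj_by U b)) C"


section \<open>The natural reversible extension\<close>

text \<open>The added isolated point is \<^const>\<open>None\<close>.\<close>

definition add_isolated :: "'a topology \<Rightarrow> 'a option topology" where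
  "add_isolated X = topology (\<lambda>V. V \<subseteq> insert None (Some ` topspace X) \<and> openin X {x. Some x \<in> V})"

lemma openin_add_isolated:
  "openin (add_isolated X) V \<longleftrightarrow>
     V \<subseteq> insert None (Some ` topspace X) \<and> openin X {x. Some x \<in> V}"
proof -
  have "istopology (\<lambda>V. V \<subseteq> insert None (Some ` topspace X) \<and> openin X {x. Some x \<in> V})"
    unfolding istopology_def
  proof (intro conjI allI impI)
    fix S T assume *: "S \<subseteq> insert None (Some ` topspace X) \<and> openin X {x. Some x \<in> S}"
      "T \<subseteq> insert None (Some ` topspace X) \<and> openin X {x. Some x \<in> T}"
    have "{x. Some x \<in> S \<inter> T} = {x. Some x \<in> S} \<inter> {x. Some x \<in> T}" by auto
    with * show "openin X {x. Some x \<in> S \<inter> T}" by auto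
    from * show "S \<inter> T \<subseteq> insert None (Some ` topspace X)" by auto
  next
    fix K assume *: "\<forall>S\<in>K. S \<subseteq> insert None (Some ` topspace X) \<and> openin X {x. Some x \<in> S}"
    have "{x. Some x \<in> \<Union>K} = (\<Union>S\<in>K. {x. Some x \<in> S})" by auto
    with * show "openin X {x. Some x \<in> \<Union>K}" by auto
    from * show "\<Union>K \<subseteq> insert None (Some ` topspace X)" by auto
  qed
  then show ?thesis by (simp add: add_isolated_def topology_inverse')
qed

definition ext_level :: "'a set \<Rightarrow> ('a \<Rightarrow> 'a) \<Rightarrow> 'a set \<Rightarrow> nat \<Rightarrow> (nat \<Rightarrow> 'a option) set" where
  "ext_level M \<alpha> Y N =
     {x. (\<forall>n\<le>N. x n \<in> Some ` M) \<and> (\<forall>n>N. x n = None) \<and>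
         (\<forall>n\<in>{1..N}. map_option \<alpha> (x n) = x (n - 1)) \<and> x N \<in> Some ` Y}"

definition ext_level_inf :: "'a set \<Rightarrow> ('a \<Rightarrow> 'a) \<Rightarrow> (nat \<Rightarrow> 'a option) set" where
  "ext_level_inf M \<alpha> =
     {x. (\<forall>n. x n \<in> Some ` M) \<and> (\<forall>n\<ge>1. map_option \<alpha> (x n) = x (n - 1))}"

definition reversible_ext :: "'a topology \<Rightarrow> ('a \<Rightarrow> 'a) \<Rightarrow> 'a set \<Rightarrow> (nat \<Rightarrow> 'a option) topology" where
  "reversible_ext X \<alpha> Y =
     subtopology (product_topology (\<lambda>_. add_isolated X) UNIV)
       ((\<Union>N. ext_level (topspace X) \<alpha> Y N) \<union> ext_level_inf (topspace X) \<alpha>)"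

definition reversible_ext_map :: "('a \<Rightarrow> 'a) \<Rightarrow> (nat \<Rightarrow> 'a option) \<Rightarrow> (nat \<Rightarrow> 'a option)" where
  "reversible_ext_map \<alpha> x = case_nat (map_option \<alpha> (x 0)) x"


section \<open>The logistic family\<close>

definition logistic :: "real \<Rightarrow> real \<Rightarrow> real" where
  "logistic l x = 4 * l * x * (1 - x)"

definition gamma_map :: "real \<Rightarrow> real \<Rightarrow> real" where
  "gamma_map l t =
     4 * l * frac t * (1 - frac t) + 2 * of_int \<lfloor>t\<rfloor> + (if frac t \<le> 1/2 then 0 else 1)"

text \<open>The derivative does not exist at the points of \<open>(1/2)\<int>\<close>; there \<^const>\<open>deriv\<close> is arbitrary, which does not
  matter as these points form a null set.\<close>

definition U_fun :: "real \<Rightarrow> (real \<Rightarrow> complex) \<Rightarrow> real \<Rightarrow> complex" where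
  "U_fun l f t = complex_of_real (sqrt \<bar>deriv (gamma_map l) t\<bar>) * f (gamma_map l t)"

definition smooth_points :: "real set" where
  "smooth_points = - ((\<lambda>k. of_int k / 2) ` UNIV)"

lemma frac_half_int:
  assumes "t \<in> smooth_points" shows "0 < frac t" "frac t < 1" "frac t \<noteq> 1/2"
proof -
  have *: "t \<noteq> of_int k / 2" for k using assms by (auto simp: smooth_points_def)
  show "frac t < 1" by (rule frac_lt_1)
  have "frac t \<noteq> 0" using *[of "2 * \<lfloor>t\<rfloor>"] by (auto simp: frac_def)
  then show "0 < frac t" using frac_ge_0[of t] by linarith
  show "frac t \<noteq> 1/2" using *[of "2 * \<lfloor>t\<rfloor> + 1"] by (auto simp: frac_def field_simps)
qed

lemma open_smooth_points: "open smooth_points"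
proof -
  have "closed ((*\<^sub>R) (1/2) ` range real_of_int)"
    by (intro closed_scaling closed_of_int_image)
  then show ?thesis by (simp add: smooth_points_def open_closed image_image)
qed

lemma null_smooth_points: "AE t in lborel. t \<in> smooth_points"
proof (rule AE_I')
  show "range (\<lambda>k::int. real_of_int k / 2) \<in> null_sets lborel"
    by (intro countable_imp_null_set_lborel) simp
qed (auto simp: smooth_points_def)

lemma gamma_map_deriv:
  assumes "t \<in> smooth_points"
  shows "(gamma_map l has_real_derivative 4 * l * (1 - 2 * frac t)) (at t)"
proof -
  define k :: int where "k = \<lfloor>t\<rfloor>"
  define c where "c = (if frac t \<le> 1/2 then 0 else 1 :: real)"
  define V where "V = (if frac t \<le> 1/2 then {real_of_int k <..< real_of_int k + 1/2} else {real_of_int k + 1/2 <..< real_of_int k + 1})"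
  note fr = frac_half_int[OF assms]
  have V: "open V" "t \<in> V"
    using fr unfolding V_def k_def frac_def by (auto split: if_splits)
  define q where "q = (\<lambda>s::real. 4 * l * (s - real_of_int k) * (1 - (s - real_of_int k)) + 2 * real_of_int k + c)"
  have q: "q s = gamma_map l s" if "s \<in> V" for s
  proof -
    have "\<lfloor>s\<rfloor> = k" using that by (auto simp: V_def floor_eq_iff split: if_splits)
    then have "frac s = s - k" by (simp add: frac_def)
    then have "(frac s \<le> 1/2) = (frac t \<le> 1/2)" using that by (auto simp: V_def split: if_splits)
    then show ?thesis using \<open>\<lfloor>s\<rfloor> = k\<close> \<open>frac s = s - k\<close> by (simp add: q_def gamma_map_def c_def)
  qed
  have "(q has_real_derivative 4 * l * (1 - 2 * (t - k))) (at t)"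
    unfolding q_def by (auto intro!: derivative_eq_intros simp: algebra_simps)
  then have "(gamma_map l has_real_derivative 4 * l * (1 - 2 * (t - k))) (at t)"
    by (rule has_field_derivative_transform_within_open[OF _ V q])
  then show ?thesis by (simp add: k_def frac_def)
qed

lemma gamma_map_inj:
  assumes l: "0 < l" "l \<le> 1" shows "inj_on (gamma_map l) smooth_points"
proof (rule inj_onI)
  fix s t assume st: "s \<in> smooth_points" "t \<in> smooth_points" and eq: "gamma_map l s = gamma_map l t"
  define b where "b = (\<lambda>t::real. if frac t \<le> 1/2 then 0 else 1 :: int)"
  have fl: "\<lfloor>gamma_map l u\<rfloor> = 2 * \<lfloor>u\<rfloor> + b u" if u: "u \<in> smooth_points" for u
  proof -
    note fr = frac_half_int[OF u]
    have "0 < (1 - 2 * frac u)\<^sup>2" using fr by simp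
    then have 1: "4 * (frac u * (1 - frac u)) < 1" by (simp add: power2_eq_square algebra_simps)
    have 0: "0 < frac u * (1 - frac u)" using fr by simp
    have "4 * l * frac u * (1 - frac u) = l * (4 * (frac u * (1 - frac u)))" by simp
    also have "\<dots> \<le> 1 * (4 * (frac u * (1 - frac u)))"
      using l 0 by (intro mult_right_mono) auto
    finally have "4 * l * frac u * (1 - frac u) < 1" using 1 by simp
    moreover have "0 < 4 * l * frac u * (1 - frac u)" using fr l by simp
    ultimately show ?thesis unfolding gamma_map_def b_def
      by (intro floor_unique) (auto split: if_splits)
  qed
  have "2 * \<lfloor>s\<rfloor> + b s = 2 * \<lfloor>t\<rfloor> + b t" using fl[OF st(1)] fl[OF st(2)] eq by simp
  moreover have "b s \<in> {0, 1}" "b t \<in> {0, 1}" by (auto simp: b_def)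
  ultimately have fle: "\<lfloor>s\<rfloor> = \<lfloor>t\<rfloor>" and be: "b s = b t" by auto presburger+
  have "4 * l * frac s * (1 - frac s) = 4 * l * frac t * (1 - frac t)"
    using eq fle be unfolding gamma_map_def b_def by (auto split: if_splits)
  then have "4 * l * ((frac s - frac t) * (1 - frac s - frac t)) = 0" by (simp add: algebra_simps)
  then have "frac s = frac t \<or> frac s + frac t = 1" using l by auto
  then have "frac s = frac t"
    using be frac_half_int[OF st(1)] frac_half_int[OF st(2)] by (auto simp: b_def split: if_splits)
  then show "s = t" using fle by (simp add: frac_def)
qed

lemma gamma_map_measurable [measurable]: "gamma_map l \<in> borel_measurable borel"
  unfolding gamma_map_def frac_def by measurable

lemma deriv_gamma_map_measurable [measurable]: "deriv (gamma_map l) \<in> borel_measurable borel"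
proof (rule measurable_discrete_difference)
  show "(\<lambda>t. 4 * l * (1 - 2 * frac t)) \<in> borel_measurable borel"
    unfolding frac_def by measurable
  show "countable (- smooth_points)" by (simp add: smooth_points_def)
  show "4 * l * (1 - 2 * frac t) = deriv (gamma_map l) t" if "t \<notin> - smooth_points" for t
    using DERIV_imp_deriv[OF gamma_map_deriv, of t l] that by simp
qed auto

lemma gamma_map_change_of_variables:
  fixes F :: "real \<Rightarrow> real"
  assumes l: "0 < l" "l \<le> 1" and F: "integrable lborel F"
  defines "G \<equiv> \<lambda>t. \<bar>deriv (gamma_map l) t\<bar> * F (gamma_map l t)"
  shows "integrable lborel G"
    and "integral\<^sup>L lborel G = integral (gamma_map l ` smooth_points) F"
proof -
  have [measurable]: "F \<in> borel_measurable borel" using F by auto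
  have Gm [measurable]: "G \<in> borel_measurable borel" unfolding G_def by measurable
  have der: "(gamma_map l has_real_derivative deriv (gamma_map l) t) (at t within smooth_points)"
    if "t \<in> smooth_points" for t
    using gamma_map_deriv[OF that, of l] DERIV_imp_deriv[OF gamma_map_deriv[OF that, of l]]
    by (metis has_field_derivative_at_within)
  have cont: "continuous_on smooth_points (gamma_map l)"
    using der by (meson DERIV_continuous continuous_on_eq_continuous_within)
  have "open (gamma_map l ` smooth_points)"
    by (rule invariance_of_domain[OF cont open_smooth_points gamma_map_inj[OF l]])
  then have S': "gamma_map l ` smooth_points \<in> sets lebesgue" by auto
  have "integrable lebesgue F" using F by (simp add: integrable_completion)
  then have "F absolutely_integrable_on UNIV" by (simp add: set_integrable_def)
  then have "F absolutely_integrable_on (gamma_map l ` smooth_points)"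
    by (rule set_integrable_subset[OF _ S']) simp
  then have *: "G absolutely_integrable_on smooth_points"
      "integral smooth_points G = integral (gamma_map l ` smooth_points) F"
    using has_absolute_integral_change_of_variables_1'[OF _ der gamma_map_inj[OF l],
        of F "integral (gamma_map l ` smooth_points) F"] open_smooth_points
    unfolding G_def by auto
  have [measurable]: "smooth_points \<in> sets borel" using open_smooth_points by simp
  have ae: "AE t in lborel. indicator smooth_points t *\<^sub>R G t = G t"
    using null_smooth_points by eventually_elim simp
  have "integrable lborel (\<lambda>t. indicator smooth_points t *\<^sub>R G t)"
    using *(1) unfolding set_integrable_def by (subst (asm) integrable_completion) auto
  then show "integrable lborel G"
    by (subst integrable_cong_AE[OF _ _ ae, symmetric]) auto
  have "integral\<^sup>L lborel G = integral\<^sup>L lborel (\<lambda>t. indicator smooth_points t *\<^sub>R G t)"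
    by (rule integral_cong_AE[symmetric, OF _ _ ae]) auto
  also have "\<dots> = integral\<^sup>L lebesgue (\<lambda>t. indicator smooth_points t *\<^sub>R G t)"
    by (rule integral_completion[symmetric]) auto
  also have "\<dots> = integral smooth_points G"
    using set_lebesgue_integral_eq_integral(2)[OF *(1)] by (simp add: set_lebesgue_integral_def)
  finally show "integral\<^sup>L lborel G = integral (gamma_map l ` smooth_points) F" using *(2) by simp
qed

lemma U_fun_norm2:
  "(cmod (U_fun l f t))\<^sup>2 = \<bar>deriv (gamma_map l) t\<bar> * (cmod (f (gamma_map l t)))\<^sup>2"
  by (simp add: U_fun_def norm_mult power_mult_distrib)

lemma U_fun_square_integrable:
  assumes "0 < l" "l \<le> 1" and f: "square_integrable f"
  shows "square_integrable (U_fun l f)"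
proof -
  have [measurable]: "f \<in> borel_measurable borel" using f by (simp add: square_integrable_def)
  have "U_fun l f \<in> borel_measurable borel" unfolding U_fun_def by measurable
  then show ?thesis
    using gamma_map_change_of_variables(1)[OF assms(1,2), of "\<lambda>s. (cmod (f s))\<^sup>2"] f
    by (simp add: square_integrable_def U_fun_norm2)
qed

text \<open>Hence \<open>U_op\<close> below does not depend on the choice of representatives.\<close>

lemma U_fun_respects:
  assumes l: "0 < l" "l \<le> 1" and fg: "L2_rel f g"
  shows "L2_rel (U_fun l f) (U_fun l g)"
proof -
  have sq: "square_integrable f" "square_integrable g" and ae: "AE t in lborel. f t = g t"
    using fg by (auto simp: L2_rel_def)
  define h where "h = (\<lambda>t. f t + (-1) * g t)"
  have h: "square_integrable h" unfolding h_def
    by (intro square_integrable_add square_integrable_scale sq)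
  have Uh: "square_integrable (U_fun l h)" by (rule U_fun_square_integrable[OF l h])
  let ?F = "\<lambda>s. (cmod (h s))\<^sup>2"
  have Fi: "integrable lborel ?F" using h by (simp add: square_integrable_def)
  have "AE s in lebesgue. ?F s = 0"
    using AE_completion[OF ae] by eventually_elim (simp add: h_def)
  then have "negligible {s. ?F s \<noteq> 0}"
    by (simp add: negligible_iff_null_sets completion.AE_iff_null_sets AE_iff_null_sets)
  then have "integral (gamma_map l ` smooth_points) ?F = integral (gamma_map l ` smooth_points) (\<lambda>_. 0)"
    by (rule integral_spike) auto
  then have "integral\<^sup>L lborel (\<lambda>t. (cmod (U_fun l h t))\<^sup>2) = 0"
    using gamma_map_change_of_variables(2)[OF l Fi] by (simp add: U_fun_norm2)
  then have "AE t in lborel. (cmod (U_fun l h t))\<^sup>2 = 0"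
    using Uh by (subst (asm) integral_nonneg_eq_0_iff_AE) (auto simp: square_integrable_def)
  then have "AE t in lborel. U_fun l f t = U_fun l g t"
    by eventually_elim (auto simp: U_fun_def h_def)
  then show ?thesis using U_fun_square_integrable[OF l] sq by (simp add: L2_rel_def)
qed

definition U_op :: "real \<Rightarrow> L2_op" where
  "U_op l f = abs_L2 (U_fun l (rep_L2 f))"

definition mult_op :: "(real \<Rightarrow> complex) \<Rightarrow> L2_op" where
  "mult_op a f = abs_L2 (\<lambda>t. a t * rep_L2 f t)"

definition alg_A :: "L2_op set" where
  "alg_A = {mult_op a | a. (\<forall>t. a (t + 1) = a t) \<and> continuous_on {0..<1} a \<and>
                            (\<exists>z. (a \<longlongrightarrow> z) (at_left 1))}"

definition alg_B :: "real \<Rightarrow> L2_op set" where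
  "alg_B l = Cstar (\<Union>n. {(adj (U_op l) ^^ n) \<circ> a \<circ> (U_op l ^^ n) | a. a \<in> alg_A})"

definition ext_Y :: "real \<Rightarrow> real set" where
  "ext_Y l = (if l < 1 then {l..1} else {})"

lemma ext_Y_admissible:
  assumes "0 < l" "l \<le> 1"
  shows "closed (ext_Y l)" "{0..1} - logistic l ` {0..1} \<subseteq> ext_Y l"
proof -
  show "closed (ext_Y l)" by (simp add: ext_Y_def)
  have "x \<in> logistic l ` {0..1}" if "0 \<le> x" "x \<le> l" for x
  proof (rule image_eqI)
    define s where "s = sqrt (1 - x / l)"
    have s: "0 \<le> s" "s \<le> 1" "s\<^sup>2 = 1 - x / l"
      using that assms by (auto simp: s_def)
    have "logistic l ((1 - s) / 2) = l * (1 - s\<^sup>2)"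
      by (simp add: logistic_def power2_eq_square field_simps)
    then show "x = logistic l ((1 - s) / 2)" using assms s by simp
    show "(1 - s) / 2 \<in> {0..1}" using s by auto
  qed
  then show "{0..1} - logistic l ` {0..1} \<subseteq> ext_Y l"
    using assms by (force simp: ext_Y_def)
qed

definition ext_M :: "real \<Rightarrow> (nat \<Rightarrow> real option) topology" where
  "ext_M l = reversible_ext (top_of_set {0..1}) (logistic l) (ext_Y l)"

definition ext_alpha :: "real \<Rightarrow> (nat \<Rightarrow> real option) \<Rightarrow> (nat \<Rightarrow> real option)" where
  "ext_alpha l = reversible_ext_map (logistic l)"

end

theory Submission
  imports Defs
begin

text \<open>
Both sides are identified with \<open>C(K)\<close>, where \<open>K\<close> is a compact subset of \<open>nat \<Rightarrow> real\<close> homeomorphic to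
the extension. Every real number \<open>t\<close> has an itinerary in \<open>K\<close>: the fractional parts of \<open>t\<close> and of its
successive preimages under \<open>\<gamma>\<close>, which stop at the first point outside the range of \<open>\<gamma>\<close>. Multiplication
by \<open>F \<circ> itinerary\<close> represents \<open>C(K)\<close> on \<open>L\<^sup>2\<close>. As \<open>\<gamma>\<close> acts on itineraries by prepending a
coordinate, conjugation by \<open>U\<close> becomes composition with the extended map, and conjugation by \<open>U\<^sup>*\<close>
becomes composition with its inverse, extended by zero. The set of \<open>t\<close> whose itinerary lies in a
given nonempty open subset of \<open>K\<close> is never null, so the representation is isometric and its image is
closed. The image contains the generators of the algebra, and it is generated by them by the
Stone-Weierstrass theorem, since the coordinates separate the points of \<open>K\<close>.
\<close>

section \<open>Multiplication operators\<close>

text \<open>The delicate point is faithfulness. An almost-everywhere statement about itineraries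
  constrains one real variable, whereas a neighbourhood in \<open>K\<close> prescribes several
  coordinates linked by a two-to-one map. Two facts close the gap: \<gamma> pulls null sets back to
  null sets, because its derivative vanishes at no smooth point, and a condition on the entries 0 to
  N of a sequence becomes, after N pullbacks, an open condition on \<open>frac t\<close>. Sequences
  that stop fit the same scheme, because a whole interval of starting points, (l, 1), stops at once
  and for l < 1 its closure is exactly Y. For l = 1 no itinerary stops, in agreement with the empty
  Y. The code of the added point lies at positive distance from [0, 1], so having stopped by a given
  index is a clopen condition on \<open>K\<close>. Extension by zero off the range of the extended
  map therefore preserves continuity. This keeps conjugation by the adjoint of U inside the algebra,
  and it makes \<delta> surjective with a complementary ideal.\<close>

lemma L2_rel_self [simp]: "L2_rel f f \<longleftrightarrow> square_integrable f"
  by (simp add: L2_rel_def)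

lemma rep_L2_square_integrable: "square_integrable (rep_L2 x)"
  using Quotient_rep_reflp[OF Quotient_L2] by simp

lemma abs_rep_L2: "abs_L2 (rep_L2 x) = x"
  by (rule Quotient_abs_rep[OF Quotient_L2])

lemma abs_L2_eq_iff:
  assumes "square_integrable f" "square_integrable g"
  shows "abs_L2 f = abs_L2 g \<longleftrightarrow> (AE t in lborel. f t = g t)"
  using Quotient_rel[OF Quotient_L2, of f g] assms by (auto simp: L2_rel_def)

lemma rep_abs_L2:
  assumes "square_integrable f"
  shows "AE t in lborel. rep_L2 (abs_L2 f) t = f t"
  using abs_L2_eq_iff[of "rep_L2 (abs_L2 f)" f] assms
  by (simp add: rep_L2_square_integrable abs_rep_L2)

lemma L2_cases:
  obtains f where "square_integrable f" "x = abs_L2 f"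
  using rep_L2_square_integrable[of x] abs_rep_L2[of x] by metis

lemma cinner_abs_L2:
  "square_integrable f \<Longrightarrow> square_integrable g \<Longrightarrow>
    cinner (abs_L2 f) (abs_L2 g) = (\<integral>t. f t * cnj (g t) \<partial>lborel)"
  by (simp add: cinner.abs_eq)

lemma norm_abs_L2:
  assumes "square_integrable f"
  shows "norm (abs_L2 f) = sqrt (\<integral>t. (cmod (f t))\<^sup>2 \<partial>lborel)"
proof -
  have "(\<integral>t. f t * cnj (f t) \<partial>lborel) = complex_of_real (\<integral>t. (cmod (f t))\<^sup>2 \<partial>lborel)"
    unfolding complex_norm_square[symmetric] of_real_power[symmetric]
    by (rule integral_complex_of_real)
  then show ?thesis
    by (simp add: norm_L2_def inner_L2_def cinner_abs_L2 assms)
qed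

text \<open>\<open>adj\<close> is a definite description, so each adjoint below is found by
  exhibiting a candidate. Uniqueness is nondegeneracy of the real inner product, the real part of
  \<open>cinner\<close>.\<close>

lemma adj_eqI:
  assumes "\<And>x y. cinner (T x) y = cinner x (S y)"
  shows "adj T = S"
  unfolding adj_def
proof (rule the_equality)
  fix S' assume "\<forall>f g. cinner (T f) g = cinner f (S' g)"
  then have "\<forall>x. x \<bullet> S' y = x \<bullet> S y" for y
    using assms by (simp add: inner_L2_def)
  then show "S' = S"
    unfolding vector_eq_ldot by (rule ext)
qed (use assms in blast)

lemma cscale_real: "cscale (complex_of_real r) x = r *\<^sub>R x"
  by (cases x rule: L2_cases) (simp add: cscale.abs_eq scaleR_L2.abs_eq)

lemma bounded_opsI:
  assumes "\<And>x y. T (x + y) = T x + T y" "\<And>c x. T (cscale c x) = cscale c (T x)"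
    "\<And>x. norm (T x) \<le> norm x * K"
  shows "T \<in> bounded_ops"
proof -
  have "bounded_linear T"
    by (rule bounded_linear_intro[of T K]) (use assms in \<open>auto simp flip: cscale_real\<close>)
  then show ?thesis using assms by (simp add: bounded_ops_def)
qed

text \<open>A bound at every point instead of an essential bound: the symbols to come are obtained
  from continuous functions on compact sets, for which it is automatic.\<close>

definition bounded_borel :: "(real \<Rightarrow> complex) \<Rightarrow> bool" where
  "bounded_borel g \<longleftrightarrow> g \<in> borel_measurable borel \<and> bounded (range g)"

lemma bounded_borelI:
  assumes "g \<in> borel_measurable borel" "\<And>t. cmod (g t) \<le> c"
  shows "bounded_borel g"
  using assms by (auto simp: bounded_borel_def bounded_iff)

lemma bounded_borelE:
  assumes "bounded_borel g"
  obtains c where "g \<in> borel_measurable borel" "0 \<le> c" "\<And>t. cmod (g t) \<le> c"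
proof -
  obtain c where "\<And>t. cmod (g t) \<le> c"
    using assms by (auto simp: bounded_borel_def bounded_iff)
  moreover from this have "0 \<le> c" by (rule order_trans[OF norm_ge_zero])
  ultimately show thesis using that assms by (auto simp: bounded_borel_def)
qed

lemma square_integrable_bounded_mult:
  assumes g: "g \<in> borel_measurable borel" "\<And>t. cmod (g t) \<le> c" and f: "square_integrable f"
  shows "square_integrable (\<lambda>t. g t * f t)"
    and "(\<integral>t. (cmod (g t * f t))\<^sup>2 \<partial>lborel) \<le> c\<^sup>2 * (\<integral>t. (cmod (f t))\<^sup>2 \<partial>lborel)"
proof -
  have [measurable]: "f \<in> borel_measurable borel" "g \<in> borel_measurable borel"
    using f g by (auto simp: square_integrable_def)
  have le: "(cmod (g t * f t))\<^sup>2 \<le> c\<^sup>2 * (cmod (f t))\<^sup>2" for t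
    unfolding norm_mult power_mult_distrib by (intro mult_right_mono power_mono g) auto
  have int: "integrable lborel (\<lambda>t. c\<^sup>2 * (cmod (f t))\<^sup>2)"
    using f by (simp add: square_integrable_def)
  have int': "integrable lborel (\<lambda>t. (cmod (g t * f t))\<^sup>2)"
    by (rule Bochner_Integration.integrable_bound[OF int]) (use le in \<open>auto simp: abs_mult\<close>)
  then show "square_integrable (\<lambda>t. g t * f t)"
    by (simp add: square_integrable_def)
  have "(\<integral>t. (cmod (g t * f t))\<^sup>2 \<partial>lborel) \<le> (\<integral>t. c\<^sup>2 * (cmod (f t))\<^sup>2 \<partial>lborel)"
    by (rule integral_mono[OF int' int le])
  then show "(\<integral>t. (cmod (g t * f t))\<^sup>2 \<partial>lborel) \<le> c\<^sup>2 * (\<integral>t. (cmod (f t))\<^sup>2 \<partial>lborel)"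
    by simp
qed

lemma bounded_borel_mult_square_integrable:
  "bounded_borel g \<Longrightarrow> square_integrable f \<Longrightarrow> square_integrable (\<lambda>t. g t * f t)"
  by (elim bounded_borelE) (rule square_integrable_bounded_mult)

lemma mult_op_abs_L2:
  assumes "bounded_borel g" "square_integrable f"
  shows "mult_op g (abs_L2 f) = abs_L2 (\<lambda>t. g t * f t)"
  unfolding mult_op_def
  using rep_abs_L2[OF assms(2)]
  by (subst abs_L2_eq_iff)
    (auto intro!: bounded_borel_mult_square_integrable assms rep_L2_square_integrable)

lemma norm_mult_op_le:
  assumes "g \<in> borel_measurable borel" "\<And>t. cmod (g t) \<le> c"
  shows "norm (mult_op g x) \<le> c * norm x"
proof (cases x rule: L2_cases)
  case (1 f)
  have c: "0 \<le> c" using assms(2) by (rule order_trans[OF norm_ge_zero])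
  note sq = square_integrable_bounded_mult[OF assms 1(1)]
  have "norm (mult_op g x) = sqrt (\<integral>t. (cmod (g t * f t))\<^sup>2 \<partial>lborel)"
    using 1 sq by (simp add: mult_op_abs_L2 bounded_borelI[OF assms] norm_abs_L2)
  also have "\<dots> \<le> sqrt (c\<^sup>2 * (\<integral>t. (cmod (f t))\<^sup>2 \<partial>lborel))"
    using sq(2) by (rule real_sqrt_le_mono)
  also have "\<dots> = c * norm x"
    using 1 c by (simp add: real_sqrt_mult norm_abs_L2)
  finally show ?thesis .
qed

lemma
  assumes "bounded_borel g" "bounded_borel h"
  shows bounded_borel_add: "bounded_borel (\<lambda>t. g t + h t)"
    and bounded_borel_mult: "bounded_borel (\<lambda>t. g t * h t)"
proof -
  obtain c d where c: "g \<in> borel_measurable borel" "\<And>t. cmod (g t) \<le> c"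
    and d: "h \<in> borel_measurable borel" "\<And>t. cmod (h t) \<le> d" "0 \<le> d"
    using assms by (metis bounded_borelE)
  note [measurable] = c(1) d(1)
  have 0: "0 \<le> c" using c(2) by (rule order_trans[OF norm_ge_zero])
  show "bounded_borel (\<lambda>t. g t + h t)"
    by (rule bounded_borelI[where c = "c + d"]) (auto intro!: norm_triangle_mono c d)
  show "bounded_borel (\<lambda>t. g t * h t)"
    by (rule bounded_borelI[where c = "c * d"]) (auto simp: norm_mult intro!: mult_mono c d 0)
qed

lemma bounded_borel_const [simp]: "bounded_borel (\<lambda>t. c)"
  by (rule bounded_borelI[where c = "cmod c"]) auto

lemma bounded_borel_cnj: "bounded_borel g \<Longrightarrow> bounded_borel (\<lambda>t. cnj (g t))"
  by (elim bounded_borelE, rule bounded_borelI) auto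

lemma mult_op_eqI:
  assumes "bounded_borel g" "\<And>f. square_integrable f \<Longrightarrow> T (abs_L2 f) = abs_L2 (\<lambda>t. g t * f t)"
  shows "T = mult_op g"
  by (rule ext, rename_tac x, case_tac x rule: L2_cases) (simp add: assms mult_op_abs_L2)

lemma mult_op_in_bounded_ops:
  assumes "bounded_borel g" shows "mult_op g \<in> bounded_ops"
proof -
  obtain c where c: "g \<in> borel_measurable borel" "\<And>t. cmod (g t) \<le> c"
    using assms by (metis bounded_borelE)
  note sq = bounded_borel_mult_square_integrable[OF assms]
  show ?thesis
  proof (rule bounded_opsI)
    fix x y show "mult_op g (x + y) = mult_op g x + mult_op g y"
    proof (cases x rule: L2_cases; cases y rule: L2_cases)
      fix u v assume "square_integrable u" "x = abs_L2 u" "square_integrable v" "y = abs_L2 v"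
      then show ?thesis
        by (simp add: plus_L2.abs_eq mult_op_abs_L2[OF assms] square_integrable_add sq algebra_simps)
    qed
  next
    fix k x show "mult_op g (cscale k x) = cscale k (mult_op g x)"
      by (cases x rule: L2_cases)
        (simp add: cscale.abs_eq mult_op_abs_L2[OF assms] square_integrable_scale sq,
          simp add: mult_ac)
  next
    fix x show "norm (mult_op g x) \<le> norm x * c"
      using norm_mult_op_le[OF c] by (simp add: mult.commute)
  qed
qed

lemma
  assumes g: "bounded_borel g" and h: "bounded_borel h"
  shows mult_op_add: "(\<lambda>x. mult_op g x + mult_op h x) = mult_op (\<lambda>t. g t + h t)"
    and mult_op_comp: "mult_op g \<circ> mult_op h = mult_op (\<lambda>t. g t * h t)"
  using bounded_borel_mult_square_integrable[OF g] bounded_borel_mult_square_integrable[OF h] g h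
  by (auto intro!: mult_op_eqI bounded_borel_add bounded_borel_mult
      simp: mult_op_abs_L2 plus_L2.abs_eq algebra_simps)

lemma mult_op_scale:
  assumes g: "bounded_borel g"
  shows "(\<lambda>x. cscale c (mult_op g x)) = mult_op (\<lambda>t. c * g t)"
  using bounded_borel_mult_square_integrable[OF g] g
  by (auto intro!: mult_op_eqI bounded_borel_mult
      simp: mult_op_abs_L2 cscale.abs_eq algebra_simps)

lemma mult_op_one: "mult_op (\<lambda>t. 1) = id"
  by (auto intro!: mult_op_eqI[symmetric])

lemma mult_op_zero: "mult_op (\<lambda>t. 0) = (\<lambda>x. 0)"
  by (auto intro!: mult_op_eqI[symmetric] simp: zero_L2_def)

lemma adj_mult_op:
  assumes g: "bounded_borel g"
  shows "adj (mult_op g) = mult_op (\<lambda>t. cnj (g t))"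
proof (rule adj_eqI)
  note g' = bounded_borel_cnj[OF g]
  fix x y show "cinner (mult_op g x) y = cinner x (mult_op (\<lambda>t. cnj (g t)) y)"
  proof (cases x rule: L2_cases; cases y rule: L2_cases)
    fix u v assume "square_integrable u" "x = abs_L2 u" "square_integrable v" "y = abs_L2 v"
    then show ?thesis
      by (simp add: mult_op_abs_L2[OF g] mult_op_abs_L2[OF g'] cinner_abs_L2
          bounded_borel_mult_square_integrable[OF g] bounded_borel_mult_square_integrable[OF g'],
        simp add: mult_ac)
  qed
qed

lemma square_integrable_indicator:
  assumes "E \<in> sets borel" "E \<subseteq> {-n..n}"
  shows "square_integrable (indicator E)"
proof -
  have "emeasure lborel E \<le> emeasure lborel {-n..n}"
    using assms by (intro emeasure_mono) auto
  then have "emeasure lborel E < \<infinity>"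
    by (rule le_less_trans) (simp add: emeasure_lborel_Icc_eq)
  then have "integrable lborel (indicator E :: real \<Rightarrow> real)"
    using assms by (simp add: integrable_indicator_iff)
  moreover have "(cmod (indicator E t))\<^sup>2 = indicat_real E t" for t
    by (simp add: indicator_def)
  ultimately show ?thesis
    using assms by (simp add: square_integrable_def)
qed

text \<open>Tested on the indicators of the sets \<open>{t \<in> {-n..n}. c < cmod (g t)}\<close>.\<close>

lemma AE_le_of_mult_op_bound:
  assumes g: "bounded_borel g" and le: "\<And>x. norm (mult_op g x) \<le> c * norm x" and c: "0 \<le> c"
  shows "AE t in lborel. cmod (g t) \<le> c"
proof -
  have [measurable]: "g \<in> borel_measurable borel" using g by (simp add: bounded_borel_def)
  have "AE t in lborel. \<not> (t \<in> {-real n..real n} \<and> c < cmod (g t))" for n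
  proof -
    define E where "E = {t. t \<in> {-real n..real n} \<and> c < cmod (g t)}"
    have [measurable]: "E \<in> sets borel" unfolding E_def by measurable
    have sE: "square_integrable (indicator E)"
      by (rule square_integrable_indicator[of _ "real n"]) (auto simp: E_def)
    note sgE = bounded_borel_mult_square_integrable[OF g sE]
    have cE: "cmod (indicator E t) = indicator E t" for t by (simp add: indicator_def)
    have "sqrt (\<integral>t. (cmod (g t * indicator E t))\<^sup>2 \<partial>lborel) \<le> c * sqrt (\<integral>t. (cmod (indicator E t))\<^sup>2 \<partial>lborel)"
      using le[of "abs_L2 (indicator E)"] sE sgE g by (simp add: mult_op_abs_L2 norm_abs_L2)
    also have "\<dots> = sqrt (\<integral>t. c\<^sup>2 * (cmod (indicator E t))\<^sup>2 \<partial>lborel)"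
      using c by (simp add: real_sqrt_mult)
    finally have *: "(\<integral>t. (cmod (g t * indicator E t))\<^sup>2 \<partial>lborel) \<le> (\<integral>t. c\<^sup>2 * (cmod (indicator E t))\<^sup>2 \<partial>lborel)"
      by simp
    \<comment> \<open>By * the integral of \<open>h\<close> is at most 0, while \<open>h\<close> is
      positive on \<open>E\<close> and zero elsewhere; this forces \<open>E\<close> to be
      null.\<close>
    define h where "h t = (cmod (g t * indicator E t))\<^sup>2 - c\<^sup>2 * (cmod (indicator E t))\<^sup>2" for t
    have pos: "h t > 0" if "t \<in> E" for t
      using that c by (auto simp: h_def E_def power_strict_mono)
    have h0: "h t = 0" if "t \<notin> E" for t using that by (simp add: h_def)
    have hnn: "h t \<ge> 0" for t using pos[of t] h0[of t] by (cases "t \<in> E") auto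
    have inth: "integrable lborel h" and "(\<integral>t. h t \<partial>lborel) = (\<integral>t. (cmod (g t * indicator E t))\<^sup>2 \<partial>lborel) - (\<integral>t. c\<^sup>2 * (cmod (indicator E t))\<^sup>2 \<partial>lborel)"
      using sE sgE unfolding h_def square_integrable_def
      by (auto intro!: Bochner_Integration.integral_diff)
    with * have "(\<integral>t. h t \<partial>lborel) \<le> 0" by simp
    moreover have "(\<integral>t. h t \<partial>lborel) \<ge> 0" by (rule Bochner_Integration.integral_nonneg) (use hnn in auto)
    ultimately have "(\<integral>t. h t \<partial>lborel) = 0" by simp
    then have "AE t in lborel. h t = 0"
      using integral_nonneg_eq_0_iff_AE[OF inth] hnn by auto
    then show ?thesis
      by eventually_elim (use pos in \<open>force simp: E_def\<close>)
  qed
  then have "AE t in lborel. \<forall>n::nat. \<not> (t \<in> {-real n..real n} \<and> c < cmod (g t))"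
    by (simp only: AE_all_countable) blast
  then show ?thesis
  proof eventually_elim
    case (elim t)
    obtain n :: nat where "\<bar>t\<bar> \<le> real n" using real_arch_simple by blast
    then show ?case using elim by (auto simp: abs_le_iff not_less)
  qed
qed

lemma mult_op_diff:
  assumes g: "bounded_borel g" and h: "bounded_borel h"
  shows "mult_op g x - mult_op h x = mult_op (\<lambda>t. g t - h t) x"
proof -
  have h': "bounded_borel (\<lambda>t. (-1) * h t)" by (intro bounded_borel_mult h bounded_borel_const)
  have "mult_op g x - mult_op h x = mult_op g x + cscale (-1) (mult_op h x)"
    using cscale_real[of "-1" "mult_op h x"] by simp
  also have "\<dots> = mult_op (\<lambda>t. g t + (-1) * h t) x"
    using fun_cong[OF mult_op_scale[OF h, of "-1"], of x] fun_cong[OF mult_op_add[OF g h'], of x] by simp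
  finally show ?thesis by simp
qed

lemma mult_op_cong_AE:
  assumes g: "bounded_borel g" and h: "bounded_borel h" and ae: "AE t in lborel. g t = h t"
  shows "mult_op g = mult_op h"
proof (rule mult_op_eqI[OF h])
  fix f assume f: "square_integrable f"
  have "AE t in lborel. g t * f t = h t * f t" using ae by eventually_elim simp
  then show "mult_op g (abs_L2 f) = abs_L2 (\<lambda>t. h t * f t)"
    by (simp add: mult_op_abs_L2 g f abs_L2_eq_iff bounded_borel_mult_square_integrable[OF g f]
        bounded_borel_mult_square_integrable[OF h f])
qed

section \<open>Continuity of the reversible extension\<close>

lemma topspace_add_isolated [simp]: "topspace (add_isolated X) = insert None (Some ` topspace X)"
proof -
  have "{x. Some x \<in> insert None (Some ` topspace X)} = topspace X" by auto
  then have "openin (add_isolated X) (insert None (Some ` topspace X))"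
    by (simp add: openin_add_isolated)
  then show ?thesis
    by (intro equalityI openin_subset) (auto simp: openin_add_isolated dest!: openin_topspace[THEN openin_add_isolated[THEN iffD1], THEN conjunct1, THEN subsetD])
qed

lemma continuous_map_option:
  assumes "continuous_map X X \<alpha>"
  shows "continuous_map (add_isolated X) (add_isolated X) (map_option \<alpha>)"
  unfolding continuous_map
proof (intro conjI allI impI)
  show "map_option \<alpha> ` topspace (add_isolated X) \<subseteq> topspace (add_isolated X)"
    using continuous_map_image_subset_topspace[OF assms] by auto
  fix V assume "openin (add_isolated X) V"
  then have V: "V \<subseteq> insert None (Some ` topspace X)" "openin X {x. Some x \<in> V}"
    by (auto simp: openin_add_isolated)
  have "{x. Some x \<in> {y \<in> topspace (add_isolated X). map_option \<alpha> y \<in> V}} =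
      {x \<in> topspace X. \<alpha> x \<in> {x. Some x \<in> V}}" by auto
  moreover have "openin X \<dots>" by (rule openin_continuous_map_preimage[OF assms V(2)])
  ultimately show "openin (add_isolated X) {y \<in> topspace (add_isolated X). map_option \<alpha> y \<in> V}"
    by (auto simp: openin_add_isolated)
qed

lemma topspace_reversible_ext:
  assumes "Y \<subseteq> topspace X"
  shows "topspace (reversible_ext X \<alpha> Y) =
    (\<Union>N. ext_level (topspace X) \<alpha> Y N) \<union> ext_level_inf (topspace X) \<alpha>"
proof -
  have "x n \<in> insert None (Some ` topspace X)" if "x \<in> ext_level (topspace X) \<alpha> Y N" for x n N
    using that unfolding ext_level_def by (cases "n \<le> N") auto
  then show ?thesis
    unfolding reversible_ext_def topspace_subtopology topspace_product_topology
    by (auto simp: PiE_iff ext_level_inf_def)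
qed

lemma reversible_ext_coordinate:
  "continuous_map (reversible_ext X \<alpha> Y) (add_isolated X) (\<lambda>x. x n)"
  unfolding reversible_ext_def
  by (rule continuous_map_from_subtopology) (rule continuous_map_product_projection, simp)

text \<open>Prepending raises the level by one and leaves the last entry, the one constrained to
  \<open>Y\<close>, unchanged.\<close>

lemma reversible_ext_map_in:
  assumes \<alpha>: "\<alpha> ` topspace X \<subseteq> topspace X" and Y: "Y \<subseteq> topspace X"
    and x: "x \<in> topspace (reversible_ext X \<alpha> Y)"
  shows "reversible_ext_map \<alpha> x \<in> topspace (reversible_ext X \<alpha> Y)"
proof -
  have 0: "map_option \<alpha> (x 0) \<in> Some ` topspace X"
    if "x 0 \<in> Some ` topspace X" using that \<alpha> by auto
  show ?thesis
    using x unfolding topspace_reversible_ext[OF Y] Un_iff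
  proof (elim disjE)
    assume "x \<in> (\<Union>N. ext_level (topspace X) \<alpha> Y N)"
    then obtain N where N: "x \<in> ext_level (topspace X) \<alpha> Y N" by blast
    then have "\<forall>n\<le>N. x n \<in> Some ` topspace X" "\<forall>n>N. x n = None" "x N \<in> Some ` Y"
      and st: "\<And>n. 1 \<le> n \<Longrightarrow> n \<le> N \<Longrightarrow> map_option \<alpha> (x n) = x (n - 1)"
      by (auto simp: ext_level_def)
    then have "reversible_ext_map \<alpha> x \<in> ext_level (topspace X) \<alpha> Y (Suc N)"
      using 0 by (auto simp: ext_level_def reversible_ext_map_def split: nat.split)
    then show "reversible_ext_map \<alpha> x \<in> (\<Union>N. ext_level (topspace X) \<alpha> Y N) \<or> reversible_ext_map \<alpha> x \<in> ext_level_inf (topspace X) \<alpha>"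
      by blast
  next
    assume "x \<in> ext_level_inf (topspace X) \<alpha>"
    then have "\<forall>n. x n \<in> Some ` topspace X"
      and st: "\<And>n. 1 \<le> n \<Longrightarrow> map_option \<alpha> (x n) = x (n - 1)"
      by (auto simp: ext_level_inf_def)
    then have "reversible_ext_map \<alpha> x \<in> ext_level_inf (topspace X) \<alpha>"
      using 0 by (auto simp: ext_level_inf_def reversible_ext_map_def split: nat.split)
    then show "reversible_ext_map \<alpha> x \<in> (\<Union>N. ext_level (topspace X) \<alpha> Y N) \<or> reversible_ext_map \<alpha> x \<in> ext_level_inf (topspace X) \<alpha>"
      by blast
  qed
qed

text \<open>The original sequence survives as the tail, so the shift \<open>s\<close> inverts the
  map even where \<alpha> itself is not injective. The components of \<open>s\<close> are coordinate
  projections, hence it is continuous.\<close>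

lemma reversible_ext_homeomorphic_map:
  assumes \<alpha>: "continuous_map X X \<alpha>" and Y: "Y \<subseteq> topspace X"
  defines "E \<equiv> reversible_ext X \<alpha> Y"
  shows "homeomorphic_map E (subtopology E (reversible_ext_map \<alpha> ` topspace E)) (reversible_ext_map \<alpha>)"
proof -
  have img: "\<alpha> ` topspace X \<subseteq> topspace X" by (rule continuous_map_image_subset_topspace[OF \<alpha>])
  note inE = reversible_ext_map_in[OF img Y, folded E_def]
  have "continuous_map E (product_topology (\<lambda>_. add_isolated X) UNIV) (reversible_ext_map \<alpha>)"
    unfolding continuous_map_componentwise_UNIV
  proof
    fix n show "continuous_map E (add_isolated X) (\<lambda>x. reversible_ext_map \<alpha> x n)"
      using continuous_map_compose[OF reversible_ext_coordinate continuous_map_option[OF \<alpha>], of \<alpha> Y 0]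
        reversible_ext_coordinate[of X \<alpha> Y]
      by (cases n) (simp_all add: reversible_ext_map_def E_def comp_def)
  qed
  then have c: "continuous_map E E (reversible_ext_map \<alpha>)"
    using inE by (subst E_def) (auto simp: reversible_ext_def continuous_map_in_subtopology E_def)
  define s where "s x n = x (Suc n)" for x :: "nat \<Rightarrow> 'a option" and n
  have s: "s (reversible_ext_map \<alpha> x) = x" for x
    by (simp add: s_def reversible_ext_map_def fun_eq_iff)
  have "continuous_map E (product_topology (\<lambda>_. add_isolated X) UNIV) s"
    unfolding continuous_map_componentwise_UNIV
    by (simp add: s_def E_def reversible_ext_coordinate)
  then have "continuous_map (subtopology E (reversible_ext_map \<alpha> ` topspace E)) E s"
    using s topspace_subtopology_subset by (subst (2) E_def) (auto simp: reversible_ext_def continuous_map_in_subtopology E_def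
        intro: continuous_map_from_subtopology)
  then have "homeomorphic_maps E (subtopology E (reversible_ext_map \<alpha> ` topspace E)) (reversible_ext_map \<alpha>) s"
    using c s by (auto simp: homeomorphic_maps_def continuous_map_in_subtopology)
  then show ?thesis by (auto simp: homeomorphic_map_maps)
qed

section \<open>The adjoint of the weighted composition operator\<close>

text \<open>The inverse of \<^const>\<open>gamma_map\<close> on its range \<open>{s. 0 < frac s < l}\<close>. It is meaningful also where
  \<open>frac s = 0\<close>, so that every itinerary, and not just almost every one, is a point of the
  extension.\<close>

definition beta_map :: "real \<Rightarrow> real \<Rightarrow> real" where
  "beta_map l s =
     (let r = (1 - sqrt (1 - frac s / l)) / 2
      in if even \<lfloor>s\<rfloor> then of_int (\<lfloor>s\<rfloor> div 2) + r else of_int (\<lfloor>s\<rfloor> div 2) + 1 - r)"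

lemma beta_map_measurable [measurable]: "beta_map l \<in> borel_measurable borel"
  unfolding beta_map_def Let_def frac_def by measurable

lemma smooth_pointsI:
  assumes "frac t \<noteq> 0" "frac t \<noteq> 1/2" shows "t \<in> smooth_points"
proof -
  have "t \<noteq> of_int k / 2" for k
  proof
    assume t: "t = of_int k / 2"
    show False
    proof (cases "even k")
      case True
      then obtain j where "k = 2 * j" by blast
      then show False using t assms(1) by simp
    next
      case False
      then obtain j where "k = 2 * j + 1" by (rule oddE)
      then have "t = of_int j + 1/2" using t by simp
      moreover from this have "\<lfloor>t\<rfloor> = j" by (simp add: floor_eq_iff)
      ultimately show False using assms(2) by (simp add: frac_def)
    qed
  qed
  then show ?thesis unfolding smooth_points_def by blast
qed

lemma floor_add_fraction:
  assumes "0 \<le> r" "r < 1"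
  shows "\<lfloor>of_int k + r\<rfloor> = k" "frac (of_int k + r) = r"
proof -
  show "\<lfloor>of_int k + r\<rfloor> = k" using assms by (simp add: floor_eq_iff)
  then show "frac (of_int k + r) = r" by (simp add: frac_def)
qed

locale logistic_parameter =
  fixes l :: real
  assumes l: "0 < l" "l \<le> 1"
begin

text \<open>The completed square exhibits the maximum \<open>l\<close> at 1/2 and the two preimages
  (1 +- sqrt (1 - y / l)) / 2 of y, between which \<open>beta_map\<close> chooses by the parity of
  the floor.\<close>

lemma logistic_eq: "logistic l x = l * (1 - (1 - 2 * x)\<^sup>2)"
  by (simp add: logistic_def power2_eq_square algebra_simps)

lemma logistic_smooth:
  assumes "t \<in> smooth_points" shows "0 < logistic l (frac t)" "logistic l (frac t) < l"
proof -
  show "0 < logistic l (frac t)"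
    unfolding logistic_def using frac_half_int[OF assms] l by (intro mult_pos_pos) auto
  have "0 < l * (1 - 2 * frac t)\<^sup>2" using frac_half_int(3)[OF assms] l by simp
  then show "logistic l (frac t) < l" by (simp add: logistic_eq algebra_simps)
qed

text \<open>The logistic value lies strictly between 0 and 1, so nothing carries over into the
  integer part. The fractional part follows the logistic map, and the parity of the floor records
  the branch; this is how \<gamma> is injective over a two-to-one map.\<close>

lemma gamma_map_smooth:
  assumes "t \<in> smooth_points"
  shows "\<lfloor>gamma_map l t\<rfloor> = 2 * \<lfloor>t\<rfloor> + (if frac t \<le> 1/2 then 0 else 1)"
    and "frac (gamma_map l t) = logistic l (frac t)"
proof -
  define k where "k = 2 * \<lfloor>t\<rfloor> + (if frac t \<le> 1/2 then 0 else 1)"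
  have "gamma_map l t = of_int k + logistic l (frac t)"
    by (simp add: gamma_map_def logistic_def k_def)
  then show "\<lfloor>gamma_map l t\<rfloor> = 2 * \<lfloor>t\<rfloor> + (if frac t \<le> 1/2 then 0 else 1)"
    and "frac (gamma_map l t) = logistic l (frac t)"
    using floor_add_fraction[of "logistic l (frac t)" k] logistic_smooth[OF assms] l
    by (simp_all add: k_def)
qed

text \<open>The square root recovers 1 - 2 \<open>frac t\<close> only up to sign; the parity of the
  floor of \<gamma> t restores the sign.\<close>

lemma beta_gamma:
  assumes "t \<in> smooth_points" shows "beta_map l (gamma_map l t) = t"
proof -
  note g = gamma_map_smooth[OF assms]
  have *: "sqrt (1 - frac (gamma_map l t) / l) = \<bar>1 - 2 * frac t\<bar>"
    using l by (simp add: g(2) logistic_eq)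
  have t: "of_int \<lfloor>t\<rfloor> + frac t = t" by (simp add: frac_def)
  show ?thesis
    using t unfolding beta_map_def Let_def * g(1) by (auto simp: field_simps)
qed

lemma
  assumes s: "frac s < l"
  shows logistic_frac_beta: "logistic l (frac (beta_map l s)) = frac s"
    and beta_smooth: "0 < frac s \<Longrightarrow> beta_map l s \<in> smooth_points"
    and gamma_beta: "0 < frac s \<Longrightarrow> gamma_map l (beta_map l s) = s"
proof -
  define r where "r = (1 - sqrt (1 - frac s / l)) / 2"
  define k where "k = \<lfloor>s\<rfloor> div 2"
  have u: "0 \<le> frac s / l" "frac s / l < 1" using s l by auto
  then have r: "0 \<le> r" "r < 1/2" unfolding r_def by (auto simp: real_sqrt_le_1_iff)
  have r0: "r = 0 \<longleftrightarrow> frac s = 0" using l by (auto simp: r_def)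
  have logr: "logistic l r = frac s" "logistic l (1 - r) = frac s"
  proof -
    have "1 - 2 * r = sqrt (1 - frac s / l)"
      by (simp add: r_def field_simps)
    then show "logistic l r = frac s"
      unfolding logistic_eq using u l by simp
    moreover have "logistic l (1 - r) = logistic l r" by (simp add: logistic_def)
    ultimately show "logistic l (1 - r) = frac s" by (rule trans[rotated])
  qed
  \<comment> \<open>For \<open>r = 0\<close> and an odd floor \<open>beta_map\<close> returns the
    integer \<open>k + 1\<close>, whose fractional part is 0 instead of 1. The logistic relation
    survives because 0 and 1 have the same image, but the floor formula needs
    \<open>r \<noteq> 0\<close>.\<close>
  have fr: "frac (beta_map l s) = (if even \<lfloor>s\<rfloor> \<or> r = 0 then r else 1 - r)"
    and fl: "r \<noteq> 0 \<Longrightarrow> \<lfloor>beta_map l s\<rfloor> = k"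
    using floor_add_fraction[of r k] floor_add_fraction[of "1 - r" k] r
    by (auto simp: beta_map_def Let_def add_diff_eq simp flip: r_def k_def)
  then show "logistic l (frac (beta_map l s)) = frac s" using logr by auto
  assume s0: "0 < frac s"
  then show sm: "beta_map l s \<in> smooth_points"
    by (intro smooth_pointsI) (use r0 r fr in auto)
  have k: "2 * k + (if even \<lfloor>s\<rfloor> then 0 else 1) = \<lfloor>s\<rfloor>" by (auto simp: k_def elim!: oddE)
  have "gamma_map l (beta_map l s) = of_int \<lfloor>gamma_map l (beta_map l s)\<rfloor> + frac (gamma_map l (beta_map l s))"
    by (simp add: frac_def)
  also have "frac (gamma_map l (beta_map l s)) = frac s"
    using gamma_map_smooth(2)[OF sm] fr logr by auto
  also have "\<lfloor>gamma_map l (beta_map l s)\<rfloor> = \<lfloor>s\<rfloor>"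
    using gamma_map_smooth(1)[OF sm] fl fr r r0 s0 k by (auto split: if_splits)
  finally show "gamma_map l (beta_map l s) = s" by (simp add: frac_def)
qed

lemma gamma_map_image: "gamma_map l ` smooth_points = {s. 0 < frac s \<and> frac s < l}"
proof
  show "gamma_map l ` smooth_points \<subseteq> {s. 0 < frac s \<and> frac s < l}"
    using logistic_smooth gamma_map_smooth(2) by (simp add: image_subset_iff del: frac_gt_0_iff)
  show "{s. 0 < frac s \<and> frac s < l} \<subseteq> gamma_map l ` smooth_points"
    using beta_smooth gamma_beta by (force intro: image_eqI[OF sym])
qed

lemma deriv_gamma_map_nonzero:
  assumes "t \<in> smooth_points" shows "deriv (gamma_map l) t \<noteq> 0"
  using DERIV_imp_deriv[OF gamma_map_deriv[OF assms, of l]] frac_half_int[OF assms] l by simp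

section \<open>The operator U and its adjoint on representatives\<close>

lemma U_op_abs_L2:
  assumes "square_integrable f" shows "U_op l (abs_L2 f) = abs_L2 (U_fun l f)"
proof -
  have "L2_rel (U_fun l (rep_L2 (abs_L2 f))) (U_fun l f)"
    by (rule U_fun_respects[OF l]) (use rep_abs_L2[OF assms] assms in \<open>simp add: L2_rel_def rep_L2_square_integrable\<close>)
  then show ?thesis unfolding U_op_def by (subst abs_L2_eq_iff) (auto simp: L2_rel_def)
qed

text \<open>Substitution in the indicator of a null Borel set gives integral 0. The weight, the
  absolute value of the derivative, is nonzero at smooth points, so the indicator composed with
  \<gamma> vanishes almost everywhere.\<close>

lemma AE_gamma_map:
  assumes "AE t in lborel. P t" shows "AE t in lborel. P (gamma_map l t)"
proof -
  obtain N where N: "{t \<in> space lborel. \<not> P t} \<subseteq> N" "emeasure lborel N = 0" "N \<in> sets lborel"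
    using AE_E[OF assms] by blast
  let ?F = "indicat_real N"
  have Fi: "integrable lborel ?F" using N by (simp add: integrable_indicator_iff)
  have "N \<in> null_sets lebesgue" using N by (auto simp: null_sets_def)
  then have "negligible N" by (simp add: negligible_iff_null_sets)
  then have "integral (gamma_map l ` smooth_points) ?F = integral (gamma_map l ` smooth_points) (\<lambda>_. 0)"
    by (rule integral_spike) auto
  then have "integral\<^sup>L lborel (\<lambda>t. \<bar>deriv (gamma_map l) t\<bar> * ?F (gamma_map l t)) = 0"
    using gamma_map_change_of_variables(2)[OF l Fi] by simp
  then have "AE t in lborel. \<bar>deriv (gamma_map l) t\<bar> * ?F (gamma_map l t) = 0"
    using integral_nonneg_eq_0_iff_AE[OF gamma_map_change_of_variables(1)[OF l Fi]] by simp
  then show ?thesis using null_smooth_points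
  proof eventually_elim
    case (elim t)
    then show ?case using deriv_gamma_map_nonzero N(1) by (auto simp: indicator_def split: if_splits)
  qed
qed

text \<open>\<open>gamma_map_change_of_variables\<close> concerns real integrands and integrates
  over the image of \<gamma>. Vanishing off the image lets the whole line replace it; real and
  imaginary parts are then recombined.\<close>

lemma integral_gamma_map:
  fixes F :: "real \<Rightarrow> complex"
  assumes F: "integrable lborel F" "\<And>s. \<not> (0 < frac s \<and> frac s < l) \<Longrightarrow> F s = 0"
  shows "(\<integral>t. complex_of_real \<bar>deriv (gamma_map l) t\<bar> * F (gamma_map l t) \<partial>lborel) = (\<integral>s. F s \<partial>lborel)"
proof -
  have real: "integrable lborel (\<lambda>t. \<bar>deriv (gamma_map l) t\<bar> * G (gamma_map l t)) \<and>
      (\<integral>t. \<bar>deriv (gamma_map l) t\<bar> * G (gamma_map l t) \<partial>lborel) = (\<integral>s. G s \<partial>lborel)"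
    if G: "integrable lborel G" "\<And>s. \<not> (0 < frac s \<and> frac s < l) \<Longrightarrow> G s = 0" for G :: "real \<Rightarrow> real"
  proof -
    have Gl: "integrable lebesgue G" using G(1) by (simp add: integrable_completion)
    have "integral (gamma_map l ` smooth_points) G = integral UNIV G"
      unfolding gamma_map_image by (rule integral_spike_set) (auto simp: G(2) intro: negligible_subset[OF negligible_empty])
    also have "\<dots> = (\<integral>s. G s \<partial>lebesgue)"
      using set_lebesgue_integral_eq_integral(2)[of UNIV G] Gl
      by (simp add: set_integrable_def set_lebesgue_integral_def)
    also have "\<dots> = (\<integral>s. G s \<partial>lborel)"
      using G(1) by (intro integral_completion) auto
    finally show ?thesis using gamma_map_change_of_variables[OF l G(1)] by simp
  qed
  let ?H = "\<lambda>t. complex_of_real \<bar>deriv (gamma_map l) t\<bar> * F (gamma_map l t)"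
  have re: "integrable lborel (\<lambda>t. Re (?H t)) \<and> (\<integral>t. Re (?H t) \<partial>lborel) = (\<integral>s. Re (F s) \<partial>lborel)"
    using real[of "\<lambda>s. Re (F s)"] F by simp
  have im: "integrable lborel (\<lambda>t. Im (?H t)) \<and> (\<integral>t. Im (?H t) \<partial>lborel) = (\<integral>s. Im (F s) \<partial>lborel)"
    using real[of "\<lambda>s. Im (F s)"] F by simp
  have "integrable lborel (\<lambda>t. complex_of_real (Re (?H t)) + \<i> * complex_of_real (Im (?H t)))"
    by (intro Bochner_Integration.integrable_add integrable_mult_right integrable_of_real)
      (use re im in blast)+
  then have H: "integrable lborel ?H" by (simp only: complex_eq[symmetric])
  show ?thesis
    using re im integral_Re[OF H] integral_Im[OF H] integral_Re[OF F(1)] integral_Im[OF F(1)]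
    by (intro complex_eqI) simp_all
qed

text \<open>The candidate adjoint: transport along \<beta> with the reciprocal weight on the range
  of \<gamma>. Functions supported off that range are killed by U, which is why the value there is
  0.\<close>

definition U_adj_fun :: "(real \<Rightarrow> complex) \<Rightarrow> real \<Rightarrow> complex" where
  "U_adj_fun g s = (if 0 < frac s \<and> frac s < l
     then g (beta_map l s) / complex_of_real (sqrt \<bar>deriv (gamma_map l) (beta_map l s)\<bar>) else 0)"

text \<open>The change of variables theorem is an equivalence and is read backwards here: the
  weighted pullback of \<open>F\<close> is the squared modulus of \<open>g\<close>, integrable on
  the smooth points, so \<open>F\<close> is integrable on the image, outside which it is
  zero.\<close>

lemma U_adj_fun_square_integrable:
  assumes g: "square_integrable g" shows "square_integrable (U_adj_fun g)"
proof -
  have [measurable]: "g \<in> borel_measurable borel" using g by (simp add: square_integrable_def)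
  have Vm [measurable]: "U_adj_fun g \<in> borel_measurable borel" unfolding U_adj_fun_def frac_def by measurable
  define F where "F = (\<lambda>s. (cmod (U_adj_fun g s))\<^sup>2)"
  have Fm: "F \<in> borel_measurable borel" unfolding F_def by measurable
  have S: "smooth_points \<in> sets lebesgue" using open_smooth_points by auto
  have der: "(gamma_map l has_real_derivative deriv (gamma_map l) t) (at t within smooth_points)"
    if "t \<in> smooth_points" for t
    using gamma_map_deriv[OF that, of l] DERIV_imp_deriv[OF gamma_map_deriv[OF that, of l]]
    by (metis has_field_derivative_at_within)
  have eq: "\<bar>deriv (gamma_map l) t\<bar> * F (gamma_map l t) = (cmod (g t))\<^sup>2" if t: "t \<in> smooth_points" for t
  proof -
    have "0 < frac (gamma_map l t)" "frac (gamma_map l t) < l"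
      using logistic_smooth[OF t] gamma_map_smooth(2)[OF t] by auto
    then show ?thesis using deriv_gamma_map_nonzero[OF t]
      by (simp add: F_def U_adj_fun_def beta_gamma[OF t] norm_divide power_divide)
  qed
  have "integrable lebesgue (\<lambda>t. (cmod (g t))\<^sup>2)"
    using g by (simp add: integrable_completion square_integrable_def)
  then have "(\<lambda>t. (cmod (g t))\<^sup>2) absolutely_integrable_on UNIV" by (simp add: set_integrable_def)
  then have "(\<lambda>t. (cmod (g t))\<^sup>2) absolutely_integrable_on smooth_points"
    by (rule set_integrable_subset[OF _ S]) simp
  then have "(\<lambda>t. \<bar>deriv (gamma_map l) t\<bar> * F (gamma_map l t)) absolutely_integrable_on smooth_points"
    using eq by (simp cong: set_integrable_cong)
  then have "F absolutely_integrable_on gamma_map l ` smooth_points"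
    using has_absolute_integral_change_of_variables_1'[OF S der gamma_map_inj[OF l], of F]
    by blast
  then have "integrable lebesgue (\<lambda>s. indicator {s. 0 < frac s \<and> frac s < l} s *\<^sub>R F s)"
    by (simp add: set_integrable_def gamma_map_image)
  also have "(\<lambda>s. indicator {s. 0 < frac s \<and> frac s < l} s *\<^sub>R F s) = F"
    by (auto simp: F_def U_adj_fun_def indicator_def)
  finally have "integrable lborel F" using Fm by (simp add: integrable_completion)
  then show ?thesis by (simp add: square_integrable_def F_def)
qed

lemma cinner_U_fun:
  assumes f: "square_integrable f" and g: "square_integrable g"
  shows "cinner (abs_L2 (U_fun l f)) (abs_L2 g) = cinner (abs_L2 f) (abs_L2 (U_adj_fun g))"
proof -
  have [measurable]: "f \<in> borel_measurable borel" "g \<in> borel_measurable borel"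
    using f g by (simp_all add: square_integrable_def)
  note sU = U_fun_square_integrable[OF l f] and sV = U_adj_fun_square_integrable[OF g]
  have [measurable]: "U_fun l f \<in> borel_measurable borel" "U_adj_fun g \<in> borel_measurable borel"
    using sU sV by (simp_all add: square_integrable_def)
  define F where "F s = f s * cnj (U_adj_fun g s)" for s
  have [measurable]: "F \<in> borel_measurable borel" unfolding F_def by measurable
  have Fi: "integrable lborel F" unfolding F_def by (rule square_integrable_product[OF f sV])
  have "(\<integral>t. U_fun l f t * cnj (g t) \<partial>lborel) =
      (\<integral>t. complex_of_real \<bar>deriv (gamma_map l) t\<bar> * F (gamma_map l t) \<partial>lborel)"
  proof (rule integral_cong_AE)
    show "AE t in lborel. U_fun l f t * cnj (g t) = complex_of_real \<bar>deriv (gamma_map l) t\<bar> * F (gamma_map l t)"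
      using null_smooth_points
    proof eventually_elim
      case (elim t)
      \<comment> \<open>The Jacobian is \<open>q * q\<close>: one factor is the weight in
        \<open>U_fun\<close>, the other cancels the division in \<open>U_adj_fun\<close>.\<close>
      define q where "q = complex_of_real (sqrt \<bar>deriv (gamma_map l) t\<bar>)"
      have q: "complex_of_real \<bar>deriv (gamma_map l) t\<bar> = q * q" "q \<noteq> 0" "cnj q = q"
        using deriv_gamma_map_nonzero[OF elim] by (simp_all add: q_def flip: of_real_mult)
      have "0 < frac (gamma_map l t)" "frac (gamma_map l t) < l"
        using logistic_smooth[OF elim] gamma_map_smooth(2)[OF elim] by auto
      then show ?case unfolding F_def U_fun_def U_adj_fun_def beta_gamma[OF elim] q(1) q_def[symmetric]
        using q(2,3) by simp
    qed
  qed measurable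
  also have "\<dots> = (\<integral>s. F s \<partial>lborel)"
    by (rule integral_gamma_map[OF Fi]) (auto simp: F_def U_adj_fun_def)
  finally show ?thesis by (simp add: cinner_abs_L2 f g sU sV F_def)
qed

text \<open>The adjoint is first known only through the representatives picked by
  \<open>rep_L2\<close>. Since \<open>cinner_U_fun\<close> holds for every representative, testing
  against all vectors shows that the choice does not matter.\<close>

lemma adj_U_abs_L2:
  assumes g: "square_integrable g"
  shows "adj (U_op l) (abs_L2 g) = abs_L2 (U_adj_fun g)"
proof -
  have *: "adj (U_op l) = (\<lambda>y. abs_L2 (U_adj_fun (rep_L2 y)))"
  proof (rule adj_eqI)
    fix x y show "cinner (U_op l x) y = cinner x (abs_L2 (U_adj_fun (rep_L2 y)))"
      using cinner_U_fun[OF rep_L2_square_integrable[of x] rep_L2_square_integrable[of y]]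
      by (simp add: abs_rep_L2 flip: U_op_def)
  qed
  have "\<forall>x. x \<bullet> adj (U_op l) (abs_L2 g) = x \<bullet> abs_L2 (U_adj_fun g)"
  proof
    fix x show "x \<bullet> adj (U_op l) (abs_L2 g) = x \<bullet> abs_L2 (U_adj_fun g)"
    proof (cases x rule: L2_cases)
      case (1 f)
      show ?thesis
        using cinner_U_fun[OF 1(1) g] cinner_U_fun[OF 1(1) rep_L2_square_integrable[of "abs_L2 g"]]
        by (simp add: * 1 inner_L2_def abs_rep_L2)
    qed
  qed
  then show ?thesis by (simp only: vector_eq_ldot)
qed

text \<open>The weights of U and its adjoint cancel and \<beta> undoes \<gamma> almost everywhere.
  For \<open>h = 1\<close> this says that U is a coisometry.\<close>

lemma conj_by_mult_op:
  assumes h: "bounded_borel h"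
  shows "conj_by (U_op l) (mult_op h) = mult_op (\<lambda>t. h (gamma_map l t))"
proof (rule mult_op_eqI)
  obtain c where [measurable]: "h \<in> borel_measurable borel" and c: "\<And>t. cmod (h t) \<le> c"
    using h by (metis bounded_borelE)
  show hg: "bounded_borel (\<lambda>t. h (gamma_map l t))"
    by (rule bounded_borelI[of _ c]) (use c in measurable)
  fix f assume f: "square_integrable f"
  note sV = U_adj_fun_square_integrable[OF f]
  note shV = bounded_borel_mult_square_integrable[OF h sV]
  have "conj_by (U_op l) (mult_op h) (abs_L2 f) = abs_L2 (U_fun l (\<lambda>s. h s * U_adj_fun f s))"
    by (simp add: conj_by_def adj_U_abs_L2 f mult_op_abs_L2 h sV shV U_op_abs_L2)
  also have "\<dots> = abs_L2 (\<lambda>t. h (gamma_map l t) * f t)"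
  proof (subst abs_L2_eq_iff)
    show "AE t in lborel. U_fun l (\<lambda>s. h s * U_adj_fun f s) t = h (gamma_map l t) * f t"
      using null_smooth_points
    proof eventually_elim
      case (elim t)
      have "0 < frac (gamma_map l t)" "frac (gamma_map l t) < l"
        using logistic_smooth[OF elim] gamma_map_smooth(2)[OF elim] by auto
      then show ?case using deriv_gamma_map_nonzero[OF elim]
        by (simp add: U_fun_def U_adj_fun_def beta_gamma[OF elim])
    qed
  qed (auto intro: U_fun_square_integrable[OF l shV] bounded_borel_mult_square_integrable[OF hg f])
  finally show "conj_by (U_op l) (mult_op h) (abs_L2 f) = abs_L2 (\<lambda>t. h (gamma_map l t) * f t)" .
qed

text \<open>The cutoff is \<open>frac s < l\<close> although the range of \<gamma> on smooth points
  also demands \<open>0 < frac s\<close>. The difference is the null set of integers, and this form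
  is the test by which itineraries continue.\<close>

lemma adj_U_mult_op_U:
  assumes h: "bounded_borel h"
  shows "adj (U_op l) \<circ> mult_op h \<circ> U_op l =
    mult_op (\<lambda>s. if frac s < l then h (beta_map l s) else 0)"
proof (rule mult_op_eqI)
  obtain c where [measurable]: "h \<in> borel_measurable borel" and c: "\<And>t. cmod (h t) \<le> c" "0 \<le> c"
    using h by (metis bounded_borelE)
  show hg: "bounded_borel (\<lambda>s. if frac s < l then h (beta_map l s) else 0)"
    by (rule bounded_borelI[of _ c]) (use c in \<open>auto simp: frac_def\<close>)
  fix f assume f: "square_integrable f"
  note sU = U_fun_square_integrable[OF l f]
  note shU = bounded_borel_mult_square_integrable[OF h sU]
  have "(adj (U_op l) \<circ> mult_op h \<circ> U_op l) (abs_L2 f) = abs_L2 (U_adj_fun (\<lambda>s. h s * U_fun l f s))"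
    by (simp add: adj_U_abs_L2 f mult_op_abs_L2 h sU shU U_op_abs_L2)
  also have "\<dots> = abs_L2 (\<lambda>s. (if frac s < l then h (beta_map l s) else 0) * f s)"
  proof (subst abs_L2_eq_iff)
    show "AE s in lborel. U_adj_fun (\<lambda>s. h s * U_fun l f s) s =
        (if frac s < l then h (beta_map l s) else 0) * f s"
      using null_smooth_points
    proof eventually_elim
      case (elim s)
      have s: "0 < frac s" using frac_half_int[OF elim] by simp
      show ?case using deriv_gamma_map_nonzero[OF beta_smooth] s
        by (simp add: U_fun_def U_adj_fun_def gamma_beta)
    qed
  qed (auto intro: U_adj_fun_square_integrable[OF shU] bounded_borel_mult_square_integrable[OF hg f])
  finally show "(adj (U_op l) \<circ> mult_op h \<circ> U_op l) (abs_L2 f) =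
      abs_L2 (\<lambda>s. (if frac s < l then h (beta_map l s) else 0) * f s)" .
qed

section \<open>Itineraries\<close>

lemma logistic_range:
  assumes "x \<in> {0..1}" shows "logistic l x \<in> {0..l}"
proof -
  have "0 \<le> l * (1 - 2 * x)\<^sup>2" using l by simp
  then have "logistic l x \<le> l" by (simp add: logistic_eq algebra_simps)
  moreover have "0 \<le> logistic l x" using assms l by (simp add: logistic_def)
  ultimately show ?thesis by simp
qed

lemma ext_Y_subset: "ext_Y l \<subseteq> {0..1}"
  using l by (auto simp: ext_Y_def)

text \<open>A metrizable model of the extension inside \<open>nat \<Rightarrow> real\<close>: the added isolated point is
  encoded by the real number 2.\<close>

definition code_space :: "(nat \<Rightarrow> real) set" where
  "code_space = {x. x 0 \<in> {0..1} \<and>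
     (\<forall>n. x (Suc n) = 2 \<and> (x n = 2 \<or> x n \<in> ext_Y l) \<or>
          x (Suc n) \<in> {0..1} \<and> logistic l (x (Suc n)) = x n)}"

definition code_cons :: "(nat \<Rightarrow> real) \<Rightarrow> nat \<Rightarrow> real" where
  "code_cons x = case_nat (logistic l (x 0)) x"

definition code_tail :: "(nat \<Rightarrow> real) \<Rightarrow> nat \<Rightarrow> real" where
  "code_tail x n = x (Suc n)"

lemma code_cons_simps [simp]: "code_cons x 0 = logistic l (x 0)" "code_cons x (Suc n) = x n"
  by (simp_all add: code_cons_def)

lemma code_tail_cons [simp]: "code_tail (code_cons x) = x"
  by (simp add: code_tail_def fun_eq_iff)

lemma code_space_0: "x \<in> code_space \<Longrightarrow> x 0 \<in> {0..1}"
  by (simp add: code_space_def)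

lemma code_space_Suc:
  assumes "x \<in> code_space"
  shows "x (Suc n) = 2 \<and> (x n = 2 \<or> x n \<in> ext_Y l) \<or>
    x (Suc n) \<in> {0..1} \<and> logistic l (x (Suc n)) = x n"
  using assms unfolding code_space_def by blast

lemma code_space_values:
  assumes "x \<in> code_space" shows "x n \<in> {0..1} \<or> x n = 2"
  using code_space_0[OF assms] code_space_Suc[OF assms] by (cases n) auto

text \<open>A real entry after 2 would have logistic value 2, but these values lie in
  [0, l].\<close>

lemma code_space_after_2:
  assumes "x \<in> code_space" "x n = 2" shows "x (Suc n) = 2"
  using code_space_Suc[OF assms(1), of n] logistic_range[of "x (Suc n)"] assms(2) l by force

lemma code_cons_in:
  assumes "x \<in> code_space" shows "code_cons x \<in> code_space"
proof -
  have "code_cons x 0 \<in> {0..1}" using logistic_range[OF code_space_0[OF assms]] l by simp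
  moreover have "code_cons x (Suc n) = 2 \<and> (code_cons x n = 2 \<or> code_cons x n \<in> ext_Y l) \<or>
      code_cons x (Suc n) \<in> {0..1} \<and> logistic l (code_cons x (Suc n)) = code_cons x n" for n
    using code_space_0[OF assms] code_space_Suc[OF assms] by (cases n) auto
  ultimately show ?thesis by (simp only: code_space_def mem_Collect_eq) blast
qed

text \<open>With \<open>code_cons_tail\<close>, this identifies the range of
  \<open>code_cons\<close> on \<open>code_space\<close> as the part where
  \<open>x 1 \<noteq> 2\<close>.\<close>

lemma code_tail_in:
  assumes "x \<in> code_space" "x 1 \<noteq> 2" shows "code_tail x \<in> code_space"
  using assms code_space_values[OF assms(1), of 1] by (auto simp: code_space_def code_tail_def)

lemma code_cons_tail:
  assumes "x \<in> code_space" "x 1 \<noteq> 2" shows "code_cons (code_tail x) = x"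
proof
  fix n show "code_cons (code_tail x) n = x n"
    using code_space_Suc[OF assms(1), of 0] assms(2) by (cases n) (auto simp: code_tail_def)
qed

lemma continuous_on_code_cons: "continuous_on S code_cons"
proof (rule continuous_on_coordinatewise_then_product)
  fix n show "continuous_on S (\<lambda>x. code_cons x n)"
    by (cases n) (auto simp: logistic_def intro!: continuous_intros
        continuous_on_subset[OF continuous_on_product_coordinates])
qed

lemma continuous_on_code_tail: "continuous_on S code_tail"
  unfolding code_tail_def
  by (intro continuous_on_coordinatewise_then_product)
    (auto intro: continuous_on_subset[OF continuous_on_product_coordinates])

lemma compact_code_space: "compact code_space"
proof -
  have "compactin (product_topology (\<lambda>_. euclidean) UNIV) (PiE UNIV (\<lambda>_::nat. {0..2::real}))"
    by (simp add: compactin_PiE)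
  then have "compact (PiE UNIV (\<lambda>_::nat. {0..2::real}))"
    by (simp add: euclidean_product_topology)
  moreover have "closed code_space"
  proof -
    \<comment> \<open>\<open>l < 1\<close> is a constant condition, so every clause is visibly
      closed although \<open>ext_Y\<close> is defined by cases.\<close>
    have eq: "code_space = {x. 0 \<le> x 0 \<and> x 0 \<le> 1 \<and>
       (\<forall>n. x (Suc n) = 2 \<and> (x n = 2 \<or> l < 1 \<and> l \<le> x n \<and> x n \<le> 1) \<or>
          0 \<le> x (Suc n) \<and> x (Suc n) \<le> 1 \<and> 4 * l * x (Suc n) * (1 - x (Suc n)) = x n)}"
      by (auto simp: code_space_def ext_Y_def logistic_def)
    show ?thesis unfolding eq
      by (intro closed_Collect_conj closed_Collect_disj closed_Collect_all closed_Collect_const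
          closed_Collect_le closed_Collect_eq continuous_intros continuous_on_product_coordinates)
  qed
  ultimately have "compact (PiE UNIV (\<lambda>_::nat. {0..2::real}) \<inter> code_space)" by blast
  also have "PiE UNIV (\<lambda>_::nat. {0..2::real}) \<inter> code_space = code_space"
    using code_space_values by (force simp: PiE_def)
  finally show ?thesis .
qed

section \<open>Itineraries of real numbers\<close>

primrec itin :: "nat \<Rightarrow> real \<Rightarrow> real" where
  "itin 0 s = frac s"
| "itin (Suc n) s = (if frac s < l then itin n (beta_map l s) else 2)"

definition itinerary :: "real \<Rightarrow> nat \<Rightarrow> real" where
  "itinerary s n = itin n s"

lemma itinerary_0 [simp]: "itinerary s 0 = frac s"
  by (simp add: itinerary_def)

lemma itinerary_Suc: "itinerary s (Suc n) = (if frac s < l then itinerary (beta_map l s) n else 2)"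
  by (simp add: itinerary_def)

lemma itinerary_in: "itinerary s \<in> code_space"
proof -
  have "itin (Suc n) s = 2 \<and> (itin n s = 2 \<or> itin n s \<in> ext_Y l) \<or>
          itin (Suc n) s \<in> {0..1} \<and> logistic l (itin (Suc n) s) = itin n s" for n
  proof (induction n arbitrary: s)
    case 0
    show ?case
    proof (cases "frac s < l")
      case True
      then show ?thesis using logistic_frac_beta[of s] by (simp add: less_imp_le frac_lt_1)
    next
      case False
      \<comment> \<open>Failure of the test puts \<open>frac s\<close> in [l, 1), which forces
        \<open>l < 1\<close>; a stopping entry is thus always admissible.\<close>
      then have "frac s \<in> ext_Y l"
        using frac_lt_1[of s] l by (auto simp: ext_Y_def)
      then show ?thesis using False by simp
    qed
  next
    case (Suc n)
    then show ?case by (cases "frac s < l") (simp_all del: itin.simps(2) add: itin.simps(2)[of "Suc n"] itin.simps(2)[of n s])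
  qed
  then show ?thesis
    by (simp add: code_space_def itinerary_def less_imp_le frac_lt_1 del: itin.simps(2))
qed

text \<open>The point \<gamma> t passes the test \<open>frac s < l\<close> and its first preimage is
  t itself, so the backward orbit of t follows after one new entry.\<close>

lemma itinerary_gamma:
  assumes "t \<in> smooth_points" shows "itinerary (gamma_map l t) = code_cons (itinerary t)"
proof
  fix n show "itinerary (gamma_map l t) n = code_cons (itinerary t) n"
    using logistic_smooth[OF assms]
    by (cases n) (simp_all add: itinerary_Suc gamma_map_smooth[OF assms] beta_gamma[OF assms])
qed

lemma itinerary_measurable [measurable]: "itinerary \<in> borel_measurable borel"
proof (rule measurable_coordinatewise_then_product)
  fix n show "(\<lambda>s. itinerary s n) \<in> borel_measurable borel"
    unfolding itinerary_def
  proof (induction n)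
    case (Suc n)
    note [measurable] = Suc
    show ?case unfolding itin.simps frac_def by measurable
  qed (simp add: frac_def)
qed

section \<open>Density of itineraries in the compact model\<close>

lemma code_cons_funpow:
  "(code_cons ^^ N) x i = (if i \<le> N then (logistic l ^^ (N - i)) (x 0) else x (i - N))"
proof (induction N arbitrary: i)
  case (Suc N)
  show ?case
    by (cases i) (simp_all add: Suc)
qed simp

text \<open>Read backwards, the entries up to a real entry form its forward orbit. Conditions on
  finitely many coordinates thereby reduce to conditions on the last one.\<close>

lemma code_space_backward:
  assumes x: "x \<in> code_space" and "x N \<noteq> 2" "i \<le> N"
  shows "x i = (logistic l ^^ (N - i)) (x N)"
  using assms(2,3)
proof (induction N)
  case (Suc N)
  then have *: "logistic l (x (Suc N)) = x N" "x (Suc N) \<in> {0..1}"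
    using code_space_Suc[OF x, of N] by auto
  then have "x N \<noteq> 2" using logistic_range[OF *(2)] l by auto
  show ?case
  proof (cases "i = Suc N")
    case False
    then have "i \<le> N" "Suc N - i = Suc (N - i)" using Suc.prems by auto
    then show ?thesis using Suc.IH[OF \<open>x N \<noteq> 2\<close>] * by (simp add: funpow_swap1)
  qed simp
qed simp

lemma continuous_logistic_funpow: "continuous_on UNIV (logistic l ^^ k)"
proof (induction k)
  case (Suc k)
  have "continuous_on UNIV (\<lambda>x. logistic l ((logistic l ^^ k) x))"
    unfolding logistic_def[of l "(logistic l ^^ k) _"] by (intro continuous_intros Suc)
  then show ?case by (simp add: comp_def)
qed (simp add: id_def)

text \<open>Iterating the hypothesis along \<open>\<gamma>\<close> frees finitely many coordinates: they are then
  continuous functions of \<open>frac t\<close> alone.\<close>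

lemma itinerary_dense:
  assumes W: "open W" and ae: "AE t in lborel. itinerary t \<notin> W"
  shows "W \<inter> code_space = {}"
proof (rule ccontr)
  assume "W \<inter> code_space \<noteq> {}"
  then obtain x where x: "x \<in> W" "x \<in> code_space" by blast
  have ae_pow: "AE t in lborel. (code_cons ^^ N) (itinerary t) \<notin> W" for N
  proof (induction N)
    case (Suc N)
    show ?case using AE_gamma_map[OF Suc] null_smooth_points
      by eventually_elim (simp add: itinerary_gamma funpow_swap1)
  qed (simp add: ae)
  have "openin (product_topology (\<lambda>_. euclidean) UNIV) W"
    using W by (simp add: euclidean_product_topology)
  from product_topology_open_contains_basis[OF this x(1)]
  obtain X where X: "\<And>i. x i \<in> X i" "\<And>i. open (X i)" "finite {i. X i \<noteq> UNIV}" "PiE UNIV X \<subseteq> W"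
    by (auto simp: PiE_iff)
  obtain M where M: "\<And>i. i > M \<Longrightarrow> X i = UNIV"
    using finite_nat_set_iff_bounded_le[THEN iffD1, OF X(3)] by (metis (mono_tags) mem_Collect_eq not_le)
  \<comment> \<open>\<open>N\<close> is an index past which a starting point t in (a, 1) satisfies
    all constraints by itself. Either \<open>x M\<close> is real, where nothing is prescribed after
    \<open>M\<close>, and a = 0 will do; or \<open>N\<close> is the last real index of x, and a = l
    works since every t in (l, 1) stops at once and so shows the required value 2.\<close>
  have "\<exists>N a. 0 \<le> a \<and> a < 1 \<and> x N \<in> {a..1} \<and> (\<forall>t\<in>{a<..<1}. \<forall>i>N. itinerary t (i - N) \<in> X i)"
  proof (cases "x M = 2")
    case False
    then have "x M \<in> {0..1}" using code_space_values[OF x(2)] by blast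
    then show ?thesis using M by (intro exI[of _ M] exI[of _ 0]) auto
  next
    case True
    then have "x 0 \<noteq> 2" using code_space_0[OF x(2)] by auto
    obtain N where N: "x N \<noteq> 2" "x (Suc N) = 2"
      using True \<open>x 0 \<noteq> 2\<close> by (induction M) auto
    have x2: "x i = 2" if "i > N" for i
      using that
    proof (induction i)
      case (Suc i)
      then show ?case using N(2) code_space_after_2[OF x(2), of i] by (cases "i = N") auto
    qed simp
    have tl: "itinerary t (i - N) \<in> X i" if t: "t \<in> {l<..<1}" "i > N" for t i
    proof -
      have "frac t = t" using t l by (simp add: frac_eq)
      moreover obtain m where "i - N = Suc m" using t(2) by (cases "i - N") auto
      ultimately show ?thesis
        using x2[OF t(2)] X(1)[of i] t(1) by (simp only: itinerary_Suc) simp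
    qed
    have "x N \<in> ext_Y l" using code_space_Suc[OF x(2), of N] N by auto
    then show ?thesis using tl l
      by (intro exI[of _ N] exI[of _ l]) (auto simp: ext_Y_def split: if_splits)
  qed
  then obtain N a where N: "0 \<le> a" "a < 1" "x N \<in> {a..1}"
    and tl: "\<And>t i. t \<in> {a<..<1} \<Longrightarrow> i > N \<Longrightarrow> itinerary t (i - N) \<in> X i" by blast
  define V where "V = (\<Inter>i\<in>{..N}. (logistic l ^^ (N - i)) -` X i)"
  have "open V" unfolding V_def
    by (intro open_INT finite_atMost ballI open_vimage X continuous_logistic_funpow)
  have "x N \<noteq> 2" using N by auto
  then have "x N \<in> V"
    unfolding V_def using X(1) by (auto simp flip: code_space_backward[OF x(2)])
  define Q where "Q = V \<inter> {a<..<1}"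
  have "open Q" using \<open>open V\<close> by (auto simp: Q_def)
  \<comment> \<open>\<open>x N\<close> may be an endpoint, and in particular 1, which is never a
    fractional part. It suffices that its neighbourhood \<open>V\<close> meets the open
    interval.\<close>
  have "x N \<in> closure {a<..<1}" using N by simp
  then have "Q \<noteq> {}" using \<open>open V\<close> \<open>x N \<in> V\<close> unfolding Q_def
    by (metis IntI empty_iff open_Int_closure_eq_empty)
  have sub: "(code_cons ^^ N) (itinerary t) \<in> W" if t: "t \<in> Q" for t
  proof -
    have "frac t = t" using t N by (simp add: Q_def frac_eq)
    have "(code_cons ^^ N) (itinerary t) i \<in> X i" for i
    proof (cases "i \<le> N")
      case True
      then have "(logistic l ^^ (N - i)) t \<in> X i" using t unfolding Q_def V_def by blast
      then show ?thesis using True \<open>frac t = t\<close> by (simp add: code_cons_funpow)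
    next
      case False
      then show ?thesis using t tl[of t i] by (simp add: code_cons_funpow Q_def)
    qed
    then show ?thesis using X(4) by blast
  qed
  have "AE t in lebesgue. t \<notin> Q"
    using AE_completion[OF ae_pow[of N]] by eventually_elim (use sub in blast)
  then have "negligible Q"
    by (simp add: negligible_iff_null_sets completion.AE_iff_null_sets AE_iff_null_sets)
  then show False using open_not_negligible \<open>open Q\<close> \<open>Q \<noteq> {}\<close> by blast
qed

text \<open>The set where the modulus of \<open>F\<close> exceeds \<open>c\<close> is relatively
  open and is met by itineraries of only a null set of points, hence it is empty by
  \<open>itinerary_dense\<close>.\<close>

lemma AE_itinerary_bound:
  fixes F :: "(nat \<Rightarrow> real) \<Rightarrow> complex"
  assumes F: "continuous_on code_space F" and ae: "AE t in lborel. cmod (F (itinerary t)) \<le> c"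
    and x: "x \<in> code_space"
  shows "cmod (F x) \<le> c"
proof (rule ccontr)
  assume *: "\<not> cmod (F x) \<le> c"
  have "continuous_on code_space (\<lambda>y. cmod (F y))" using F by (intro continuous_intros)
  then have "\<exists>W. open W \<and> W \<inter> code_space = (\<lambda>y. cmod (F y)) -` {c<..} \<inter> code_space"
    unfolding continuous_on_open_invariant by auto
  then obtain W where W: "open W" "W \<inter> code_space = (\<lambda>y. cmod (F y)) -` {c<..} \<inter> code_space"
    by blast
  have "AE t in lborel. itinerary t \<notin> W"
    using ae
  proof eventually_elim
    case (elim t)
    have "itinerary t \<notin> W \<inter> code_space" unfolding W(2) using elim by simp
    then show ?case using itinerary_in by blast
  qed
  then have "W \<inter> code_space = {}" by (rule itinerary_dense[OF W(1)])
  moreover have "x \<in> W \<inter> code_space" unfolding W(2) using x * by simp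
  ultimately show False by blast
qed

section \<open>The algebra as an algebra of continuous symbols\<close>

definition code_op :: "((nat \<Rightarrow> real) \<Rightarrow> complex) \<Rightarrow> L2_op" where
  "code_op F = mult_op (\<lambda>t. F (itinerary t))"

lemma code_bounded_borel:
  assumes F: "continuous_on code_space F" shows "bounded_borel (\<lambda>t. F (itinerary t))"
proof -
  have "compact (F ` code_space)" by (rule compact_continuous_image[OF F compact_code_space])
  then have "bounded (F ` code_space)" by (rule compact_imp_bounded)
  then have "bounded (range (\<lambda>t. F (itinerary t)))"
    by (rule bounded_subset) (auto intro: itinerary_in)
  moreover have "(\<lambda>t. F (itinerary t)) \<in> borel_measurable borel"
    by (rule measurable_compose[OF measurable_restrict_space2
          borel_measurable_continuous_on_restrict[OF F]])
      (auto intro: itinerary_in)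
  ultimately show ?thesis by (simp add: bounded_borel_def)
qed

lemma
  assumes F: "continuous_on code_space F" and G: "continuous_on code_space G"
  shows code_op_add: "(\<lambda>x. code_op F x + code_op G x) = code_op (\<lambda>y. F y + G y)"
    and code_op_comp: "code_op F \<circ> code_op G = code_op (\<lambda>y. F y * G y)"
    and code_op_diff: "code_op F x - code_op G x = code_op (\<lambda>y. F y - G y) x"
  unfolding code_op_def
  by (rule mult_op_add mult_op_comp mult_op_diff; intro code_bounded_borel F G)+

lemma
  assumes F: "continuous_on code_space F"
  shows code_op_scale: "(\<lambda>x. cscale c (code_op F x)) = code_op (\<lambda>y. c * F y)"
    and code_op_adj: "adj (code_op F) = code_op (\<lambda>y. cnj (F y))"
    and code_op_bounded: "code_op F \<in> bounded_ops"
  unfolding code_op_def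
  by (rule mult_op_scale adj_mult_op mult_op_in_bounded_ops; intro code_bounded_borel F)+

lemma code_op_zero: "code_op (\<lambda>y. 0) = (\<lambda>x. 0)" and code_op_one: "code_op (\<lambda>y. 1) = id"
  by (simp_all add: code_op_def mult_op_zero mult_op_one)

lemma code_op_cong: "(\<And>x. x \<in> code_space \<Longrightarrow> F x = G x) \<Longrightarrow> code_op F = code_op G"
  by (simp add: code_op_def itinerary_in)

lemma norm_code_op_le:
  assumes "continuous_on code_space F" "\<And>x. x \<in> code_space \<Longrightarrow> cmod (F x) \<le> c"
  shows "norm (code_op F x) \<le> c * norm x"
  unfolding code_op_def
  by (rule norm_mult_op_le)
    (use code_bounded_borel[OF assms(1)] assms(2) itinerary_in in \<open>auto simp: bounded_borel_def\<close>)

text \<open>The converse of \<open>norm_code_op_le\<close>. Together they say that the operator norm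
  of \<open>code_op F\<close> is the supremum of the modulus of \<open>F\<close> over
  \<open>code_space\<close>.\<close>

lemma code_op_bound:
  assumes F: "continuous_on code_space F" and "\<And>x. norm (code_op F x) \<le> c * norm x" "0 \<le> c"
    and y: "y \<in> code_space"
  shows "cmod (F y) \<le> c"
  by (rule AE_itinerary_bound[OF F _ y], rule AE_le_of_mult_op_bound[OF code_bounded_borel[OF F]])
    (use assms(2,3) in \<open>simp_all add: code_op_def\<close>)

lemma code_op_inject:
  assumes F: "continuous_on code_space F" and G: "continuous_on code_space G"
    and "code_op F = code_op G" "y \<in> code_space"
  shows "F y = G y"
proof -
  have "cmod (F y - G y) \<le> 0"
    by (rule code_op_bound[where F = "\<lambda>y. F y - G y"])
      (use assms in \<open>auto simp flip: code_op_diff intro!: continuous_intros\<close>)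
  then show ?thesis by simp
qed

lemma onorm_code_op_diff_le:
  assumes F: "continuous_on code_space F" and G: "continuous_on code_space G"
    and "\<And>x. x \<in> code_space \<Longrightarrow> cmod (F x - G x) \<le> c" "0 \<le> c"
  shows "onorm (\<lambda>x. code_op F x - code_op G x) \<le> c"
  unfolding code_op_diff[OF F G]
  by (rule onorm_bound[OF assms(4)], rule norm_code_op_le) (use assms in \<open>auto intro!: continuous_intros\<close>)

lemma code_op_conj:
  assumes F: "continuous_on code_space F"
  shows "conj_by (U_op l) (code_op F) = code_op (\<lambda>y. F (code_cons y))"
proof -
  have F': "continuous_on code_space (\<lambda>y. F (code_cons y))"
    by (rule continuous_on_compose2[OF F continuous_on_code_cons]) (auto intro: code_cons_in)
  have [measurable]: "(\<lambda>t. F (itinerary t)) \<in> borel_measurable borel"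
    using code_bounded_borel[OF F] by (simp add: bounded_borel_def)
  have "(\<lambda>t. F (itinerary (gamma_map l t))) \<in> borel_measurable borel"
    by (rule measurable_compose[OF gamma_map_measurable]) measurable
  then have "bounded_borel (\<lambda>t. F (itinerary (gamma_map l t)))"
    using code_bounded_borel[OF F] by (auto simp: bounded_borel_def elim: bounded_subset)
  then show ?thesis
    unfolding code_op_def conj_by_mult_op[OF code_bounded_borel[OF F]]
    using null_smooth_points code_bounded_borel[OF F']
    by (intro mult_op_cong_AE) (auto simp: itinerary_gamma elim!: eventually_mono)
qed

section \<open>Inverting composition with the extended map\<close>

definition code_lift :: "((nat \<Rightarrow> real) \<Rightarrow> complex) \<Rightarrow> (nat \<Rightarrow> real) \<Rightarrow> complex" where
  "code_lift F y = (if y 1 \<le> 1 then F (code_tail y) else 0)"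

lemma code_lift_cons: "x \<in> code_space \<Longrightarrow> code_lift F (code_cons x) = F x"
  using code_space_0[of x] by (simp add: code_lift_def)

text \<open>On \<open>code_space\<close> every entry is at most 1 or equal to 2, so the two cases
  live on complementary closed sets and are glued without a matching condition.\<close>

lemma continuous_on_split_2:
  fixes F G :: "(nat \<Rightarrow> real) \<Rightarrow> complex"
  assumes "continuous_on {y \<in> code_space. y n \<le> 1} F"
  shows "continuous_on code_space (\<lambda>y. if y n \<le> 1 then F y else 0)"
proof -
  have cl: "closedin (top_of_set code_space) (code_space \<inter> {y. y n \<le> 1})"
    "closedin (top_of_set code_space) (code_space \<inter> {y. 2 \<le> y n})"
    by (intro closedin_closed_Int closed_Collect_le continuous_intros continuous_on_product_coordinates)+
  have un: "code_space \<inter> {y. y n \<le> 1} \<union> code_space \<inter> {y. 2 \<le> y n} = code_space"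
  proof (rule set_eqI)
    fix y show "y \<in> code_space \<inter> {y. y n \<le> 1} \<union> code_space \<inter> {y. 2 \<le> y n} \<longleftrightarrow> y \<in> code_space"
      using code_space_values[of y n] by auto
  qed
  have "continuous_on (code_space \<inter> {y. y n \<le> 1} \<union> code_space \<inter> {y. 2 \<le> y n})
      (\<lambda>y. if y n \<le> 1 then F y else 0)"
  proof (rule continuous_on_cases_local)
    show "continuous_on (code_space \<inter> {y. y n \<le> 1}) F"
      by (rule continuous_on_subset[OF assms]) auto
  qed (simp_all only: un cl continuous_on_const, auto)
  then show ?thesis by (simp only: un)
qed

lemma continuous_on_code_lift:
  assumes F: "continuous_on code_space F" shows "continuous_on code_space (code_lift F)"
  unfolding code_lift_def
  by (rule continuous_on_split_2, rule continuous_on_compose2[OF F continuous_on_code_tail])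
    (auto intro!: code_tail_in)

text \<open>An itinerary has a real entry at index 1 exactly if \<open>frac s < l\<close>, and its
  tail is then the itinerary of \<beta> s. The two symbols therefore agree at every
  \<open>s\<close>.\<close>

lemma code_op_lift:
  assumes F: "continuous_on code_space F"
  shows "adj (U_op l) \<circ> code_op F \<circ> U_op l = code_op (code_lift F)"
proof -
  have "(if frac s < l then F (itinerary (beta_map l s)) else 0) = code_lift F (itinerary s)" for s
  proof -
    have "code_tail (itinerary s) = itinerary (beta_map l s)" if "frac s < l"
      using that by (simp add: fun_eq_iff code_tail_def itinerary_Suc)
    moreover have "itinerary s 1 \<le> 1 \<longleftrightarrow> frac s < l"
      using frac_lt_1[of "beta_map l s"] by (simp add: itinerary_Suc[of s 0, simplified] less_imp_le)
    ultimately show ?thesis by (simp add: code_lift_def)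
  qed
  then show ?thesis
    unfolding code_op_def adj_U_mult_op_U[OF code_bounded_borel[OF F]] by simp
qed

text \<open>The parameter lets one closure proof serve twice: \<open>Z = {}\<close> gives the whole
  algebra, and \<open>Z = {y. y 1 = 2}\<close> the ideal on which \<delta> is injective.\<close>

definition vanishing_ops :: "(nat \<Rightarrow> real) set \<Rightarrow> L2_op set" where
  "vanishing_ops Z = {code_op F | F. continuous_on code_space F \<and> (\<forall>x\<in>code_space \<inter> Z. F x = 0)}"

lemma vanishing_opsI:
  "continuous_on code_space F \<Longrightarrow> (\<And>x. x \<in> code_space \<Longrightarrow> x \<in> Z \<Longrightarrow> F x = 0) \<Longrightarrow> code_op F \<in> vanishing_ops Z"
  by (auto simp: vanishing_ops_def)

lemma vanishing_opsE:
  assumes "T \<in> vanishing_ops Z"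
  obtains F where "continuous_on code_space F" "T = code_op F"
    "\<And>x. x \<in> code_space \<Longrightarrow> x \<in> Z \<Longrightarrow> F x = 0"
  using assms by (auto simp: vanishing_ops_def)

text \<open>Comparison through \<open>T\<close> and the isometry \<open>code_op_bound\<close> make
  the symbols uniformly Cauchy on \<open>code_space\<close>. Their uniform limit is continuous,
  inherits the zeros on \<open>Z\<close>, and represents \<open>T\<close>.\<close>

lemma vanishing_ops_limit:
  assumes X: "\<And>n. X n \<in> vanishing_ops Z" and T: "T \<in> bounded_ops"
    and lim: "(\<lambda>n. onorm (\<lambda>f. X n f - T f)) \<longlonglongrightarrow> 0"
  shows "T \<in> vanishing_ops Z"
proof -
  have "\<forall>n. \<exists>F. continuous_on code_space F \<and> X n = code_op F \<and> (\<forall>x\<in>code_space \<inter> Z. F x = 0)"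
    using X unfolding vanishing_ops_def by blast
  then obtain F where F: "\<And>n. continuous_on code_space (F n)" "\<And>n. X n = code_op (F n)"
      "\<And>n x. x \<in> code_space \<Longrightarrow> x \<in> Z \<Longrightarrow> F n x = 0"
    by (metis IntI)
  define a where "a n = onorm (\<lambda>f. X n f - T f)" for n
  have bl: "bounded_linear (\<lambda>f. X n f - T f)" for n
    using code_op_bounded[OF F(1)[of n]] T unfolding F(2)
    by (intro bounded_linear_sub) (auto simp: bounded_ops_def)
  have a: "norm (X n f - T f) \<le> a n * norm f" "0 \<le> a n" for n f
    unfolding a_def by (rule onorm[OF bl], rule onorm_pos_le[OF bl])
  have Fnm: "dist (F n y) (F m y) \<le> a n + a m" if "y \<in> code_space" for n m y
    unfolding dist_norm
  proof (rule code_op_bound[where F = "\<lambda>y. F n y - F m y", OF _ _ _ that])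
    fix f
    have "code_op (\<lambda>y. F n y - F m y) f = (X n f - T f) - (X m f - T f)"
      by (simp add: F(2) flip: code_op_diff[OF F(1) F(1)])
    also have "norm \<dots> \<le> a n * norm f + a m * norm f"
      by (rule order_trans[OF norm_triangle_ineq4]) (intro add_mono a)
    finally show "norm (code_op (\<lambda>y. F n y - F m y) f) \<le> (a n + a m) * norm f"
      by (simp add: algebra_simps)
  qed (use a F in \<open>auto intro!: continuous_intros\<close>)
  have a0: "eventually (\<lambda>n. a n < e) sequentially" if "e > 0" for e
    using order_tendstoD(2)[OF lim that] by (simp add: a_def)
  have "uniformly_Cauchy_on code_space F"
    unfolding uniformly_Cauchy_on_def
  proof (intro allI impI)
    fix e :: real assume "e > 0"
    then obtain M where "\<And>n. n \<ge> M \<Longrightarrow> a n < e / 2"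
      using a0[of "e / 2"] by (auto simp: eventually_sequentially)
    then show "\<exists>M. \<forall>x\<in>code_space. \<forall>m\<ge>M. \<forall>n\<ge>M. dist (F m x) (F n x) < e"
      using Fnm by (intro exI[of _ M]) (smt (verit) field_sum_of_halves)
  qed
  then obtain G where G: "uniform_limit code_space F G sequentially"
    using Cauchy_uniformly_convergent uniformly_convergent_on_def by blast
  have cG: "continuous_on code_space G"
    by (rule uniform_limit_theorem[OF _ G]) (auto simp: F)
  have "G x = 0" if "x \<in> code_space" "x \<in> Z" for x
    using tendsto_uniform_limitI[OF G that(1)] F(3)[OF that] by (simp add: LIMSEQ_const_iff)
  moreover have "T f = code_op G f" for f
  proof -
    have le: "norm (T f - code_op G f) \<le> 0 + e" if "e > 0" for e
    proof -
      \<comment> \<open>Adding 1 keeps the denominator of \<open>d\<close> positive when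
        \<open>f = 0\<close>.\<close>
      define p where "p = norm f + 1"
      have p: "p > 0" by (simp add: p_def add_nonneg_pos)
      define d where "d = e / (2 * p)"
      have d: "d > 0" using that p by (simp add: d_def)
      have "eventually (\<lambda>n. \<forall>x\<in>code_space. dist (F n x) (G x) < d) sequentially"
        using G d by (auto simp: uniform_limit_iff)
      then obtain n where n: "\<forall>x\<in>code_space. dist (F n x) (G x) < d" "a n < d"
        using eventually_happens[OF eventually_conj[OF _ a0[OF d]]] by auto
      have "norm (code_op (F n) f - code_op G f) \<le> d * norm f"
        unfolding code_op_diff[OF F(1) cG]
        by (rule norm_code_op_le) (use n F cG in \<open>auto simp: dist_norm less_imp_le intro!: continuous_intros\<close>)
      moreover have "norm (X n f - T f) \<le> d * norm f"
        using a(1)[of n f] mult_right_mono[of "a n" d "norm f"] n by simp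
      moreover have eq: "T f - code_op G f = (code_op (F n) f - code_op G f) - (X n f - T f)"
        by (simp add: F(2))
      have "norm (T f - code_op G f) \<le> norm (code_op (F n) f - code_op G f) + norm (X n f - T f)"
        unfolding eq by (rule norm_triangle_ineq4)
      ultimately have "norm (T f - code_op G f) \<le> d * norm f + d * norm f" by linarith
      also have "\<dots> \<le> 2 * d * p" using d by (simp add: p_def algebra_simps)
      also have "\<dots> = e" using p by (simp add: d_def)
      finally show ?thesis by simp
    qed
    have "norm (T f - code_op G f) \<le> 0" by (rule field_le_epsilon) (rule le)
    then show ?thesis by simp
  qed
  ultimately show ?thesis using vanishing_opsI[OF cG, of Z] by (metis ext)
qed

lemma cstar_vanishing_ops: "cstar_subalgebra (vanishing_ops Z)"
  unfolding cstar_subalgebra_def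
proof (intro conjI ballI allI impI)
  show "vanishing_ops Z \<subseteq> bounded_ops" by (auto elim!: vanishing_opsE intro: code_op_bounded)
  show "(\<lambda>_. 0) \<in> vanishing_ops Z"
    unfolding code_op_zero[symmetric] by (rule vanishing_opsI) auto
next
  fix S T assume "S \<in> vanishing_ops Z" "T \<in> vanishing_ops Z"
  then show "(\<lambda>f. S f + T f) \<in> vanishing_ops Z" "S \<circ> T \<in> vanishing_ops Z"
    by (auto elim!: vanishing_opsE simp: code_op_add code_op_comp
        intro!: vanishing_opsI continuous_intros)
next
  fix c T assume "T \<in> vanishing_ops Z"
  then show "(\<lambda>f. cscale c (T f)) \<in> vanishing_ops Z"
    by (auto elim!: vanishing_opsE simp: code_op_scale intro!: vanishing_opsI continuous_intros)
next
  fix T assume "T \<in> vanishing_ops Z"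
  then show "adj T \<in> vanishing_ops Z"
    by (auto elim!: vanishing_opsE simp: code_op_adj intro!: vanishing_opsI continuous_intros)
next
  fix X T assume "T \<in> bounded_ops" "\<forall>n. X n \<in> vanishing_ops Z"
    "(\<lambda>n. onorm (\<lambda>f. X n f - T f)) \<longlonglongrightarrow> 0"
  then show "T \<in> vanishing_ops Z" using vanishing_ops_limit by blast
qed

text \<open>The identification of the coefficient algebra with C([0, 1]): the left limit at 1
  becomes the value at 1, a point that no fractional part attains.\<close>

lemma alg_A_eq: "alg_A = {mult_op (\<lambda>t. a (frac t)) | a. continuous_on {0..1} a}"
proof (intro set_eqI iffI)
  fix T assume "T \<in> alg_A"
  then obtain a z where T: "T = mult_op a" and per: "\<And>t. a (t + 1) = a t"
    and cont: "continuous_on {0..<1} a" and z: "(a \<longlongrightarrow> z) (at_left 1)"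
    unfolding alg_A_def by blast
  have per': "a (t + of_int k) = a t" for t k
  proof (induction k rule: int_induct[where k = 0])
    case (step1 i)
    then show ?case using per[of "t + of_int i"] by (simp add: add.assoc)
  next
    case (step2 i)
    then show ?case using per[of "t + of_int i - 1"] by (simp add: algebra_simps)
  qed simp
  define b where "b x = (if x < 1 then a x else z)" for x
  have "continuous_on {0..1} b"
    unfolding continuous_on_def
  proof
    fix x :: real assume x: "x \<in> {0..1}"
    show "(b \<longlongrightarrow> b x) (at x within {0..1})"
    proof (cases "x < 1")
      case True
      have "(a \<longlongrightarrow> a x) (at x within {0..<1})"
        using cont x True by (simp add: continuous_on_def)
      moreover have "at x within {0..<1} = at x within {0..1}"
        by (rule at_within_nhd[of _ "{..<1}"]) (use True in auto)
      moreover have "eventually (\<lambda>y. y < 1) (at x within {0..1})"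
        using order_tendstoD(2)[OF tendsto_ident_at True] .
      then have "eventually (\<lambda>y. a y = b y) (at x within {0..1})"
        by eventually_elim (simp add: b_def)
      ultimately show ?thesis using True by (auto simp: b_def intro: Lim_transform_eventually)
    next
      case False
      then have x1: "x = 1" using x by simp
      have "at x within {0..1} = at_left x"
        unfolding x1 by (rule at_within_Icc_at_left) simp
      moreover have "eventually (\<lambda>y. a y = b y) (at_left 1)"
        unfolding eventually_at_filter by (simp add: b_def)
      then have "(b \<longlongrightarrow> z) (at_left 1)" using z by (rule Lim_transform_eventually[rotated])
      ultimately show ?thesis by (simp add: x1 b_def)
    qed
  qed
  moreover have "a t = b (frac t)" for t
    using per'[of "frac t" "\<lfloor>t\<rfloor>"] by (simp add: b_def frac_lt_1) (simp add: frac_def)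
  then have "T = mult_op (\<lambda>t. b (frac t))" unfolding T by (metis ext)
  ultimately show "T \<in> {mult_op (\<lambda>t. a (frac t)) | a. continuous_on {0..1} a}" by blast
next
  fix T assume "T \<in> {mult_op (\<lambda>t. a (frac t)) | a. continuous_on {0..1} a}"
  then obtain a where T: "T = mult_op (\<lambda>t. a (frac t))" and a: "continuous_on {0..1} a" by blast
  have "continuous_on {0..<1} (\<lambda>t. a (frac t))"
    by (rule continuous_on_eq[OF continuous_on_subset[OF a]]) (auto simp: frac_eq)
  moreover have "((\<lambda>t. a (frac t)) \<longlongrightarrow> a 1) (at_left 1)"
  proof (rule Lim_transform_eventually)
    have "(a \<longlongrightarrow> a 1) (at 1 within {0..1})" using a by (simp add: continuous_on_def)
    then show "(a \<longlongrightarrow> a 1) (at_left 1)" by (simp add: at_within_Icc_at_left)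
    have "eventually (\<lambda>t. t \<in> {0<..<1::real}) (at_left 1)" by (rule eventually_at_left_real) simp
    then show "eventually (\<lambda>t. a t = a (frac t)) (at_left 1)"
      by eventually_elim (simp add: frac_eq)
  qed
  ultimately show "T \<in> alg_A" unfolding alg_A_def T by (auto simp: frac_1_eq)
qed

definition coord_fun :: "(real \<Rightarrow> complex) \<Rightarrow> nat \<Rightarrow> (nat \<Rightarrow> real) \<Rightarrow> complex" where
  "coord_fun a n y = (if y n \<le> 1 then a (y n) else 0)"

lemma continuous_on_coord_fun:
  assumes a: "continuous_on {0..1} a" shows "continuous_on code_space (coord_fun a n)"
  unfolding coord_fun_def
  by (rule continuous_on_split_2, rule continuous_on_compose2[OF a])
    (auto dest: code_space_values[of _ n] intro: continuous_on_subset[OF continuous_on_product_coordinates])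

lemma code_op_coord_fun:
  assumes a: "continuous_on {0..1} a"
  shows "(adj (U_op l) ^^ n) \<circ> mult_op (\<lambda>t. a (frac t)) \<circ> (U_op l ^^ n) = code_op (coord_fun a n)"
proof (induction n)
  case 0
  show ?case by (simp add: code_op_def coord_fun_def less_imp_le frac_lt_1)
next
  case (Suc n)
  have "(adj (U_op l) ^^ Suc n) \<circ> mult_op (\<lambda>t. a (frac t)) \<circ> (U_op l ^^ Suc n) =
      adj (U_op l) \<circ> ((adj (U_op l) ^^ n) \<circ> mult_op (\<lambda>t. a (frac t)) \<circ> (U_op l ^^ n)) \<circ> U_op l"
    unfolding funpow_Suc_right[of n "U_op l"] by (simp add: comp_assoc)
  also have "\<dots> = code_op (code_lift (coord_fun a n))"
    unfolding Suc by (rule code_op_lift[OF continuous_on_coord_fun[OF a]])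
  also have "\<dots> = code_op (coord_fun a (Suc n))"
  proof (rule code_op_cong)
    fix y assume y: "y \<in> code_space"
    \<comment> \<open>\<open>code_lift\<close> tests entry 1 and \<open>coord_fun\<close> tests
      entry \<open>Suc n\<close>. The cutoffs agree because a sequence that has stopped at 1 is
      still stopped at \<open>Suc n\<close>.\<close>
    have "y 1 = 2 \<Longrightarrow> y (Suc n) = 2"
      using code_space_after_2[OF y] by (induction n) auto
    then show "code_lift (coord_fun a n) y = coord_fun a (Suc n) y"
      using code_space_values[OF y, of 1] by (auto simp: code_lift_def coord_fun_def code_tail_def)
  qed
  finally show ?case .
qed

text \<open>The real functions whose operators lie in \<open>B\<close> form a point-separating
  function ring, to which real Stone-Weierstrass applies. Uniform approximation is norm
  approximation of operators, so closedness of \<open>B\<close> gives all real symbols, and real and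
  imaginary parts give the rest.\<close>

lemma code_op_in_cstar_subalgebra:
  assumes B: "cstar_subalgebra B"
    and gen: "\<And>a n. continuous_on {0..1} a \<Longrightarrow> code_op (coord_fun a n) \<in> B"
    and F: "continuous_on code_space F"
  shows "code_op F \<in> B"
proof -
  have B_add: "\<And>S T. S \<in> B \<Longrightarrow> T \<in> B \<Longrightarrow> (\<lambda>f. S f + T f) \<in> B"
    and B_comp: "\<And>S T. S \<in> B \<Longrightarrow> T \<in> B \<Longrightarrow> S \<circ> T \<in> B"
    and B_scale: "\<And>c T. T \<in> B \<Longrightarrow> (\<lambda>f. cscale c (T f)) \<in> B"
    and B_lim: "\<And>X T. T \<in> bounded_ops \<Longrightarrow> (\<And>n. X n \<in> B) \<Longrightarrow>
        (\<lambda>n. onorm (\<lambda>f. X n f - T f)) \<longlonglongrightarrow> 0 \<Longrightarrow> T \<in> B"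
    using B unfolding cstar_subalgebra_def by blast+
  define R where "R = {f :: (nat \<Rightarrow> real) \<Rightarrow> real. continuous_on code_space f \<and>
      code_op (\<lambda>y. complex_of_real (f y)) \<in> B}"
  interpret function_ring_on R code_space
  proof
    show "compact code_space" by (rule compact_code_space)
    show "\<And>f. f \<in> R \<Longrightarrow> continuous_on code_space f" by (simp add: R_def)
  next
    fix f g assume fg: "f \<in> R" "g \<in> R"
    then have c: "continuous_on code_space (\<lambda>y. complex_of_real (f y))"
        "continuous_on code_space (\<lambda>y. complex_of_real (g y))"
      by (auto simp: R_def intro!: continuous_intros)
    show "(\<lambda>x. f x + g x) \<in> R"
      using fg B_add code_op_add[OF c, symmetric] by (simp add: R_def continuous_intros)
    show "(\<lambda>x. f x * g x) \<in> R"
      using fg B_comp code_op_comp[OF c, symmetric] by (simp add: R_def continuous_intros)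
  next
    fix c
    \<comment> \<open>Constants come from coordinate 0, the only one that is real at every point of
      \<open>code_space\<close>.\<close>
    have "code_op (\<lambda>y. complex_of_real c) = (\<lambda>f. cscale (complex_of_real c) (code_op (coord_fun (\<lambda>_. 1) 0) f))"
      unfolding code_op_scale[OF continuous_on_coord_fun[OF continuous_on_const]]
      by (rule code_op_cong) (use code_space_0 in \<open>auto simp: coord_fun_def\<close>)
    then show "(\<lambda>_. c) \<in> R"
      using B_scale gen[of "\<lambda>_. 1" 0] by (simp add: R_def)
  next
    fix x y assume xy: "x \<in> code_space" "y \<in> code_space" "x \<noteq> y"
    then obtain n where n: "x n \<noteq> y n" by (auto simp: fun_eq_iff)
    \<comment> \<open>The shift by 1 separates the entry 0 from the code 2, at which every
      \<open>coord_fun\<close> is zero.\<close>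
    define f where "f z = (if z n \<le> 1 then 1 + z n else 0)" for z :: "nat \<Rightarrow> real"
    have "f x \<noteq> f y"
      using n code_space_values[OF xy(1), of n] code_space_values[OF xy(2), of n]
      by (auto simp: f_def)
    moreover have *: "coord_fun (\<lambda>r. complex_of_real (1 + r)) n = (\<lambda>z. complex_of_real (f z))"
      by (auto simp: coord_fun_def f_def)
    have c: "continuous_on {0..1} (\<lambda>r::real. complex_of_real (1 + r))" by (intro continuous_intros)
    have "continuous_on code_space (\<lambda>z. Re (complex_of_real (f z)))"
      using continuous_on_coord_fun[OF c, of n] unfolding * by (rule continuous_on_Re)
    then have "f \<in> R" using gen[OF c, of n] unfolding * by (simp add: R_def)
    ultimately show "\<exists>f\<in>R. f x \<noteq> f y" by blast
  qed
  have real: "code_op (\<lambda>y. complex_of_real (f y)) \<in> B" if f: "continuous_on code_space f" for f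
  proof -
    have cf: "continuous_on code_space (\<lambda>y. complex_of_real (f y))"
      using f by (intro continuous_intros)
    have "\<forall>n. \<exists>g\<in>R. \<forall>x\<in>code_space. \<bar>f x - g x\<bar> < inverse (real (Suc n))"
      using Stone_Weierstrass_basic[OF f] by simp
    then obtain g where g: "\<And>n. g n \<in> R" "\<And>n x. x \<in> code_space \<Longrightarrow> \<bar>f x - g n x\<bar> < inverse (real (Suc n))"
      by metis
    have cg: "continuous_on code_space (\<lambda>y. complex_of_real (g n y))" for n
      using g(1)[of n] by (auto simp: R_def intro!: continuous_intros)
    show ?thesis
    proof (rule B_lim[where X = "\<lambda>n. code_op (\<lambda>y. complex_of_real (g n y))"])
      show "code_op (\<lambda>y. complex_of_real (f y)) \<in> bounded_ops" by (rule code_op_bounded[OF cf])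
      show "code_op (\<lambda>y. complex_of_real (g n y)) \<in> B" for n using g(1)[of n] by (simp add: R_def)
      show "(\<lambda>n. onorm (\<lambda>x. code_op (\<lambda>y. complex_of_real (g n y)) x -
          code_op (\<lambda>y. complex_of_real (f y)) x)) \<longlonglongrightarrow> 0"
      proof (rule tendsto_sandwich[OF _ _ tendsto_const LIMSEQ_inverse_real_of_nat])
        show "\<forall>\<^sub>F n in sequentially. 0 \<le> onorm (\<lambda>x. code_op (\<lambda>y. complex_of_real (g n y)) x -
          code_op (\<lambda>y. complex_of_real (f y)) x)"
          using code_op_bounded[OF cf] code_op_bounded[OF cg]
          by (intro always_eventually allI onorm_pos_le bounded_linear_sub) (auto simp: bounded_ops_def)
        show "\<forall>\<^sub>F n in sequentially. onorm (\<lambda>x. code_op (\<lambda>y. complex_of_real (g n y)) x -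
          code_op (\<lambda>y. complex_of_real (f y)) x) \<le> inverse (real (Suc n))"
          by (intro always_eventually allI onorm_code_op_diff_le cf cg)
            (use g(2) in \<open>auto simp: abs_minus_commute less_imp_le simp flip: of_real_diff simp del: of_nat_Suc\<close>)
      qed
    qed
  qed
  have cR: "continuous_on code_space (\<lambda>y. Re (F y))" and cI: "continuous_on code_space (\<lambda>y. Im (F y))"
    using F by (auto intro: continuous_intros)
  have c: "continuous_on code_space (\<lambda>y. complex_of_real (Re (F y)))"
    "continuous_on code_space (\<lambda>y. complex_of_real (Im (F y)))"
    "continuous_on code_space (\<lambda>y. \<i> * complex_of_real (Im (F y)))"
    using F by (auto intro!: continuous_intros)
  have "code_op (\<lambda>y. complex_of_real (Re (F y)) + \<i> * complex_of_real (Im (F y))) \<in> B"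
    unfolding code_op_add[OF c(1,3), symmetric] code_op_scale[OF c(2), symmetric]
    by (intro B_add B_scale real cR cI)
  then show ?thesis by (simp only: complex_eq[symmetric])
qed

text \<open>\<open>Cstar\<close> is an intersection: for one inclusion
  \<open>vanishing_ops {}\<close> is a member of the family, for the other the argument runs in an
  arbitrary member.\<close>

lemma alg_B_eq: "alg_B l = vanishing_ops {}"
proof
  let ?G = "\<Union>n. {(adj (U_op l) ^^ n) \<circ> a \<circ> (U_op l ^^ n) | a. a \<in> alg_A}"
  have "?G \<subseteq> vanishing_ops {}"
    by (auto simp: alg_A_eq code_op_coord_fun intro!: vanishing_opsI continuous_on_coord_fun)
  then show "alg_B l \<subseteq> vanishing_ops {}"
    unfolding alg_B_def Cstar_def using cstar_vanishing_ops by blast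
  have "code_op F \<in> B" if "cstar_subalgebra B" "?G \<subseteq> B" "continuous_on code_space F" for F B
  proof (rule code_op_in_cstar_subalgebra[OF that(1) _ that(3)])
    fix a n assume a: "continuous_on {0..1::real} (a :: real \<Rightarrow> complex)"
    then have "mult_op (\<lambda>t. a (frac t)) \<in> alg_A" unfolding alg_A_eq by blast
    then show "code_op (coord_fun a n) \<in> B"
      using that(2) unfolding code_op_coord_fun[OF a, symmetric] by blast
  qed
  then show "vanishing_ops {} \<subseteq> alg_B l"
    unfolding alg_B_def Cstar_def by (auto elim!: vanishing_opsE)
qed

section \<open>Coding the extension by real sequences\<close>

lemma ext_alpha_homeomorphic_map:
  "homeomorphic_map (ext_M l) (subtopology (ext_M l) (ext_alpha l ` topspace (ext_M l))) (ext_alpha l)"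
  unfolding ext_M_def ext_alpha_def
proof (rule reversible_ext_homeomorphic_map)
  have "continuous_on {0..1} (logistic l)" unfolding logistic_def by (intro continuous_intros)
  then show "continuous_map (top_of_set {0..1}) (top_of_set {0..1}) (logistic l)"
    using logistic_range l by (fastforce simp: continuous_map_in_subtopology)
qed (use ext_Y_subset in simp)

definition encode :: "(nat \<Rightarrow> real option) \<Rightarrow> nat \<Rightarrow> real" where
  "encode x n = case_option 2 id (x n)"

definition decode :: "(nat \<Rightarrow> real) \<Rightarrow> nat \<Rightarrow> real option" where
  "decode y n = (if y n = 2 then None else Some (y n))"

lemma topspace_ext_M:
  "topspace (ext_M l) = (\<Union>N. ext_level {0..1} (logistic l) (ext_Y l) N) \<union> ext_level_inf {0..1} (logistic l)"
  unfolding ext_M_def using ext_Y_subset by (subst topspace_reversible_ext) auto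

lemma ext_M_values: "x \<in> topspace (ext_M l) \<Longrightarrow> x n = None \<or> x n \<in> Some ` {0..1}"
  unfolding topspace_ext_M ext_level_def ext_level_inf_def using not_le by blast

lemma encode_in:
  assumes "x \<in> topspace (ext_M l)" shows "encode x \<in> code_space"
  using assms unfolding topspace_ext_M Un_iff
proof (elim disjE)
  assume "x \<in> (\<Union>N. ext_level {0..1} (logistic l) (ext_Y l) N)"
  then obtain N where N: "\<And>n. n \<le> N \<Longrightarrow> x n \<in> Some ` {0..1}" "\<And>n. n > N \<Longrightarrow> x n = None"
    "\<And>n. Suc n \<le> N \<Longrightarrow> map_option (logistic l) (x (Suc n)) = x n" "x N \<in> Some ` ext_Y l"
    by (fastforce simp: ext_level_def)
  have "encode x (Suc n) = 2 \<and> (encode x n = 2 \<or> encode x n \<in> ext_Y l) \<or>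
          encode x (Suc n) \<in> {0..1} \<and> logistic l (encode x (Suc n)) = encode x n" for n
  proof (cases "Suc n \<le> N")
    case True
    then show ?thesis using N(1)[of "Suc n"] N(3)[of n, symmetric] by (auto simp: encode_def)
  next
    case False
    then show ?thesis using N(2)[of "Suc n"] N(2)[of n] N(4) by (cases "n = N") (auto simp: encode_def)
  qed
  moreover have "encode x 0 \<in> {0..1}" using N(1)[of 0] by (auto simp: encode_def)
  ultimately show ?thesis unfolding code_space_def by blast
next
  assume x: "x \<in> ext_level_inf {0..1} (logistic l)"
  then have N: "\<And>n. x n \<in> Some ` {0..1}" "\<And>n. map_option (logistic l) (x (Suc n)) = x n"
    by (fastforce simp: ext_level_inf_def)+
  have "encode x (Suc n) \<in> {0..1} \<and> logistic l (encode x (Suc n)) = encode x n" for n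
    using N(1)[of "Suc n"] N(2)[of n, symmetric] by (auto simp: encode_def)
  moreover have "encode x 0 \<in> {0..1}" using N(1)[of 0] by (auto simp: encode_def)
  ultimately show ?thesis unfolding code_space_def by blast
qed

lemma decode_in:
  assumes y: "y \<in> code_space" shows "decode y \<in> topspace (ext_M l)"
proof -
  have st: "map_option (logistic l) (decode y (Suc n)) = decode y n" if "y (Suc n) \<noteq> 2" for n
  proof -
    have "y (Suc n) \<in> {0..1}" "logistic l (y (Suc n)) = y n"
      using code_space_Suc[OF y, of n] that by auto
    moreover from this have "y n \<noteq> 2" using logistic_range[of "y (Suc n)"] l by auto
    ultimately show ?thesis using that by (simp add: decode_def)
  qed
  have st': "map_option (logistic l) (decode y n) = decode y (n - 1)" if "y n \<noteq> 2" "1 \<le> n" for n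
    using st[of "n - 1"] that by simp
  have val: "decode y n \<in> Some ` {0..1}" if "y n \<noteq> 2" for n
    using code_space_values[OF y, of n] that by (auto simp: decode_def)
  show ?thesis
  proof (cases "\<exists>n. y n = 2")
    case False
    then have "decode y \<in> ext_level_inf {0..1} (logistic l)"
      unfolding ext_level_inf_def using val st' by blast
    then show ?thesis unfolding topspace_ext_M by blast
  next
    case True
    \<comment> \<open>\<open>M\<close> is the first stopped index. It is positive since entry 0 is
      real, so the level of the decoded point is \<open>M - 1\<close>.\<close>
    define M where "M = (LEAST n. y n = 2)"
    have M: "y M = 2" "\<And>n. n < M \<Longrightarrow> y n \<noteq> 2"
      unfolding M_def using True by (auto intro: LeastI_ex dest: not_less_Least)
    have "M \<noteq> 0" using M(1) code_space_0[OF y] by (cases M) auto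
    then obtain N where N: "M = Suc N" by (cases M) auto
    have tl: "y n = 2" if "n > N" for n
      using that
    proof (induction n)
      case (Suc n)
      then show ?case using M N code_space_after_2[OF y, of n] by (cases "n = N") auto
    qed simp
    have "y N \<in> ext_Y l" using code_space_Suc[OF y, of N] M N by auto
    then have "decode y \<in> ext_level {0..1} (logistic l) (ext_Y l) N"
      unfolding ext_level_def using val st' M(2) tl N by (auto simp: decode_def)
    then show ?thesis unfolding topspace_ext_M by blast
  qed
qed

lemma decode_encode: "x \<in> topspace (ext_M l) \<Longrightarrow> decode (encode x) = x"
proof
  fix n assume "x \<in> topspace (ext_M l)"
  then show "decode (encode x) n = x n"
    using ext_M_values[of x n] by (auto simp: decode_def encode_def)
qed

lemma encode_decode: "encode (decode y) = y"
  by (auto simp: decode_def encode_def fun_eq_iff)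

lemma encode_homeomorphic_maps:
  "homeomorphic_maps (ext_M l) (top_of_set code_space) encode decode"
proof -
  have c: "continuous_map (add_isolated (top_of_set {0..1})) euclidean (case_option 2 id :: real option \<Rightarrow> real)"
    unfolding continuous_map
  proof (intro conjI allI impI)
    fix V :: "real set" assume "openin euclidean V"
    then have "openin (top_of_set {0..1}) ({0..1} \<inter> V)" by (simp add: openin_open_Int)
    moreover have "{x. Some x \<in> {x \<in> topspace (add_isolated (top_of_set {0..1})). case_option 2 id x \<in> V}} = {0..1} \<inter> V"
      by auto
    ultimately show "openin (add_isolated (top_of_set {0..1}))
        {x \<in> topspace (add_isolated (top_of_set {0..1})). case_option 2 id x \<in> V}"
      unfolding openin_add_isolated by auto
  qed simp
  have "continuous_map (ext_M l) (product_topology (\<lambda>_. euclidean) UNIV) encode"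
    unfolding continuous_map_componentwise_UNIV
  proof
    fix n show "continuous_map (ext_M l) euclidean (\<lambda>x. encode x n)"
      using continuous_map_compose[OF reversible_ext_coordinate c, of "logistic l" "ext_Y l" n]
      by (simp add: encode_def comp_def ext_M_def)
  qed
  then have 1: "continuous_map (ext_M l) (top_of_set code_space) encode"
    using encode_in by (auto simp: euclidean_product_topology continuous_map_in_subtopology)
  have "continuous_map (top_of_set code_space) (product_topology (\<lambda>_. add_isolated (top_of_set {0..1})) UNIV) decode"
    unfolding continuous_map_componentwise_UNIV
  proof
    fix n show "continuous_map (top_of_set code_space) (add_isolated (top_of_set {0..1})) (\<lambda>x. decode x n)"
      unfolding continuous_map
    proof (intro conjI allI impI)
      show "(\<lambda>x. decode x n) ` topspace (top_of_set code_space) \<subseteq> topspace (add_isolated (top_of_set {0..1}))"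
        using code_space_values[of _ n] by (fastforce simp: decode_def)
      fix V assume "openin (add_isolated (top_of_set {0..1::real})) V"
      then have "openin (top_of_set {0..1}) {r. Some r \<in> V}" by (simp add: openin_add_isolated)
      then obtain W where W: "open W" "{r. Some r \<in> V} = {0..1} \<inter> W" by (auto simp: openin_open)
      \<comment> \<open>Cutting at 2 removes the code of the added point from \<open>W\<close>; the
        ray from 3/2 contains that code and misses [0, 1], so it is added exactly if
        \<open>None\<close> belongs to \<open>V\<close>.\<close>
      define W' where "W' = (W \<inter> {..<2}) \<union> (if None \<in> V then {3/2<..} else {})"
      have "open W'" using W(1) by (auto simp: W'_def intro!: open_Un open_Int)
      have "decode x n \<in> V \<longleftrightarrow> x n \<in> W'" if x: "x \<in> code_space" for x
        using code_space_values[OF x, of n]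
      proof
        assume r: "x n \<in> {0..1}"
        then have "decode x n \<in> V \<longleftrightarrow> x n \<in> {r. Some r \<in> V}" by (auto simp: decode_def)
        then show ?thesis unfolding W(2) using r by (auto simp: W'_def)
      next
        assume "x n = 2" then show ?thesis by (simp add: W'_def decode_def)
      qed
      then have "{x \<in> topspace (top_of_set code_space). decode x n \<in> V} = code_space \<inter> (\<lambda>x. x n) -` W'"
        by auto
      moreover have "open ((\<lambda>x::nat \<Rightarrow> real. x n) -` W')"
        by (rule open_vimage[OF \<open>open W'\<close>]) simp
      ultimately show "openin (top_of_set code_space) {x \<in> topspace (top_of_set code_space). decode x n \<in> V}"
        by (simp add: openin_open_Int)
    qed
  qed
  then have "continuous_map (top_of_set code_space) (ext_M l) decode"
    using decode_in unfolding ext_M_def reversible_ext_def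
    by (auto simp: continuous_map_in_subtopology)
  with 1 show ?thesis
    by (auto simp: homeomorphic_maps_def decode_encode encode_decode)
qed

lemma encode_ext_alpha:
  assumes "x \<in> topspace (ext_M l)" shows "encode (ext_alpha l x) = code_cons (encode x)"
proof
  have "x 0 \<noteq> None" using code_space_0[OF encode_in[OF assms]] by (cases "x 0") (simp_all add: encode_def)
  then show "encode (ext_alpha l x) n = code_cons (encode x) n" for n
    by (cases n) (auto simp: encode_def ext_alpha_def reversible_ext_map_def)
qed

lemma ext_alpha_in: "x \<in> topspace (ext_M l) \<Longrightarrow> ext_alpha l x \<in> topspace (ext_M l)"
  using ext_alpha_homeomorphic_map
  by (metis continuous_map_image_subset_topspace continuous_map_in_subtopology homeomorphic_imp_continuous_map image_subset_iff)

section \<open>The isomorphism and the spectrum\<close>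

lemma alg_BI: "continuous_on code_space F \<Longrightarrow> code_op F \<in> alg_B l"
  unfolding alg_B_eq by (rule vanishing_opsI) auto

lemma alg_BE:
  assumes "b \<in> alg_B l" obtains F where "continuous_on code_space F" "b = code_op F"
  using assms unfolding alg_B_eq by (rule vanishing_opsE) (rule that)

lemma continuous_on_comp_cons:
  "continuous_on code_space F \<Longrightarrow> continuous_on code_space (\<lambda>y. F (code_cons y))"
  for F :: "(nat \<Rightarrow> real) \<Rightarrow> complex"
  by (rule continuous_on_compose2[OF _ continuous_on_code_cons]) (auto intro: code_cons_in)

lemma conj_by_in_alg_B: "b \<in> alg_B l \<Longrightarrow> conj_by (U_op l) b \<in> alg_B l"
  by (elim alg_BE) (simp add: code_op_conj continuous_on_comp_cons alg_BI)

text \<open>The initial projection of U is the lift of the constant 1, so it belongs to the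
  commutative algebra itself and commutes with it.\<close>

lemma alg_B_generates: "generates_on (U_op l) (alg_B l)"
proof -
  have "adj (U_op l) \<circ> U_op l = adj (U_op l) \<circ> code_op (\<lambda>_. 1) \<circ> U_op l"
    by (simp add: code_op_one)
  also have "\<dots> = code_op (code_lift (\<lambda>_. 1))"
    by (rule code_op_lift) (rule continuous_on_const)
  finally have P: "adj (U_op l) \<circ> U_op l \<in> alg_B l"
    by (simp add: alg_BI continuous_on_code_lift)
  have comm: "a \<circ> b = b \<circ> a" if "a \<in> alg_B l" "b \<in> alg_B l" for a b
    using that by (auto elim!: alg_BE simp: code_op_comp mult.commute)
  show ?thesis
    unfolding generates_on_def
    using comm P conj_by_in_alg_B alg_BI[of "\<lambda>_. 1"] cstar_vanishing_ops[of "{}"]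
    by (auto simp: code_op_one alg_B_eq)
qed

text \<open>Composition with \<open>code_cons\<close> sees a symbol only on the range of
  \<open>code_cons\<close>. The ideal \<open>I\<close> consists of the symbols vanishing off that
  range, which makes \<delta> injective on it, and \<open>code_lift\<close> provides a preimage in
  \<open>I\<close> of any symbol. Hence \<open>J\<close> is the whole algebra.\<close>

lemma alg_B_partial_automorphism: "partial_automorphism (alg_B l) (conj_by (U_op l))"
proof -
  let ?\<delta> = "conj_by (U_op l)" and ?B = "alg_B l"
  define I where "I = vanishing_ops {y. y 1 = 2}"
  have hom: "op_star_hom ?B ?B ?\<delta>"
    unfolding op_star_hom_def
    by (auto elim!: alg_BE intro!: alg_BI continuous_intros continuous_on_comp_cons
        simp: code_op_conj code_op_add code_op_scale code_op_comp code_op_adj continuous_on_comp_cons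
          continuous_on_add continuous_on_mult continuous_on_cnj continuous_on_const)
  have subI: "I \<subseteq> ?B" by (auto simp: I_def elim!: vanishing_opsE intro: alg_BI)
  have idI: "closed_ideal I ?B"
    unfolding closed_ideal_def
  proof (intro conjI ballI subI)
    show "cstar_subalgebra I" unfolding I_def by (rule cstar_vanishing_ops)
    fix b c assume "b \<in> ?B" "c \<in> I"
    then show "b \<circ> c \<in> I" "c \<circ> b \<in> I"
      unfolding I_def
      by (auto elim!: alg_BE vanishing_opsE simp: code_op_comp intro!: vanishing_opsI continuous_intros)
  qed
  have idB: "closed_ideal ?B ?B"
    unfolding closed_ideal_def
    using cstar_vanishing_ops[of "{}"] by (auto simp: alg_B_eq cstar_subalgebra_def)
  have lift: "code_op (code_lift G) \<in> I \<and> ?\<delta> (code_op (code_lift G)) = code_op G"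
    if G: "continuous_on code_space G" for G
  proof
    show "code_op (code_lift G) \<in> I"
      unfolding I_def
      by (rule vanishing_opsI[OF continuous_on_code_lift[OF G]]) (simp add: code_lift_def)
    show "?\<delta> (code_op (code_lift G)) = code_op G"
      unfolding code_op_conj[OF continuous_on_code_lift[OF G]]
      by (rule code_op_cong) (rule code_lift_cons)
  qed
  then have onto: "?B \<subseteq> ?\<delta> ` I" by (auto elim!: alg_BE) (metis imageI)
  then have im: "?\<delta> ` ?B = ?B" "?\<delta> ` I = ?B" using conj_by_in_alg_B subI by blast+
  have "inj_on ?\<delta> I"
  proof (rule inj_onI)
    fix a b assume "a \<in> I" "b \<in> I" and eq: "?\<delta> a = ?\<delta> b"
    then obtain F G where F: "continuous_on code_space F" "a = code_op F"
        "\<And>x. x \<in> code_space \<Longrightarrow> x 1 = 2 \<Longrightarrow> F x = 0"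
      and G: "continuous_on code_space G" "b = code_op G"
        "\<And>x. x \<in> code_space \<Longrightarrow> x 1 = 2 \<Longrightarrow> G x = 0"
      unfolding I_def by (auto elim!: vanishing_opsE)
    have eq': "F (code_cons y) = G (code_cons y)" if "y \<in> code_space" for y
      by (rule code_op_inject[OF continuous_on_comp_cons[OF F(1)] continuous_on_comp_cons[OF G(1)] _ that])
        (use eq F G in \<open>simp add: code_op_conj\<close>)
    have "F y = G y" if y: "y \<in> code_space" for y
    proof (cases "y 1 = 2")
      case False
      then show ?thesis using eq'[OF code_tail_in[OF y False]] code_cons_tail[OF y False] by simp
    qed (use F(3) G(3) y in simp)
    then show "a = b" unfolding F G by (rule code_op_cong)
  qed
  then have "bij_betw ?\<delta> I ?B" using im by (simp add: bij_betw_def)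
  then show ?thesis
    unfolding partial_automorphism_def using hom idI idB im by blast
qed

section \<open>The isomorphism with the continuous functions on the extension\<close>

lemma cfunctions_iff:
  "u \<in> cfunctions (ext_M l) \<longleftrightarrow>
    (\<exists>F. continuous_on code_space F \<and> u = restrict (F \<circ> encode) (topspace (ext_M l)))"
proof
  note hm = encode_homeomorphic_maps[unfolded homeomorphic_maps_def]
  assume u: "u \<in> cfunctions (ext_M l)"
  then have "continuous_on code_space (u \<circ> decode)"
    using continuous_map_compose[of "top_of_set code_space" "ext_M l" decode euclidean u] hm
    by (simp add: cfunctions_def)
  moreover have "u = restrict ((u \<circ> decode) \<circ> encode) (topspace (ext_M l))"
    using u by (auto simp: cfunctions_def extensional_def decode_encode fun_eq_iff)
  ultimately show "\<exists>F. continuous_on code_space F \<and> u = restrict (F \<circ> encode) (topspace (ext_M l))"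
    by blast
next
  note hm = encode_homeomorphic_maps[unfolded homeomorphic_maps_def]
  assume "\<exists>F. continuous_on code_space F \<and> u = restrict (F \<circ> encode) (topspace (ext_M l))"
  then obtain F where F: "continuous_on code_space F" "u = restrict (F \<circ> encode) (topspace (ext_M l))"
    by blast
  have "continuous_map (ext_M l) euclidean (F \<circ> encode)"
    using hm F(1) by (intro continuous_map_compose[of _ "top_of_set code_space"]) auto
  then show "u \<in> cfunctions (ext_M l)"
    unfolding F cfunctions_def by (auto intro: continuous_map_eq)
qed

text \<open>An operator determines \<open>F\<close> only on \<open>code_space\<close>. Composition
  with \<open>encode\<close> and restriction to the extension erase the remaining ambiguity of the
  choice.\<close>

definition symbol :: "L2_op \<Rightarrow> (nat \<Rightarrow> real option) \<Rightarrow> complex" where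
  "symbol b = restrict ((SOME F. continuous_on code_space F \<and> b = code_op F) \<circ> encode) (topspace (ext_M l))"

lemma symbol_code_op:
  assumes F: "continuous_on code_space F"
  shows "symbol (code_op F) = restrict (F \<circ> encode) (topspace (ext_M l))"
proof -
  let ?G = "SOME G. continuous_on code_space G \<and> code_op F = code_op G"
  have "continuous_on code_space ?G \<and> code_op F = code_op ?G"
    by (rule someI[of _ F]) (simp add: F)
  then have "?G y = F y" if "y \<in> code_space" for y
    using code_op_inject[OF _ F _ that, of ?G] by simp
  then show ?thesis
    unfolding symbol_def using encode_in by (auto simp: restrict_def fun_eq_iff)
qed

lemma symbol_apply:
  "continuous_on code_space F \<Longrightarrow> x \<in> topspace (ext_M l) \<Longrightarrow> symbol (code_op F) x = F (encode x)"
  by (simp add: symbol_code_op)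

lemma symbol_star_iso: "star_iso_cfunctions (alg_B l) (ext_M l) symbol"
proof -
  have "inj_on symbol (alg_B l)"
  proof (rule inj_onI)
    fix a b assume "a \<in> alg_B l" "b \<in> alg_B l" and eq: "symbol a = symbol b"
    then obtain F G where F: "continuous_on code_space F" "a = code_op F"
      and G: "continuous_on code_space G" "b = code_op G" by (auto elim!: alg_BE)
    have "F y = G y" if y: "y \<in> code_space" for y
      using symbol_apply[OF F(1) decode_in[OF y]] symbol_apply[OF G(1) decode_in[OF y]] eq
      by (simp add: F G encode_decode)
    then show "a = b" unfolding F G by (rule code_op_cong)
  qed
  moreover have "symbol ` alg_B l = cfunctions (ext_M l)"
  proof (intro set_eqI iffI)
    fix u assume "u \<in> symbol ` alg_B l"
    then show "u \<in> cfunctions (ext_M l)"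
      unfolding cfunctions_iff by (auto elim!: alg_BE simp: symbol_code_op)
  next
    fix u assume "u \<in> cfunctions (ext_M l)"
    then obtain F where F: "continuous_on code_space F" "u = restrict (F \<circ> encode) (topspace (ext_M l))"
      unfolding cfunctions_iff by blast
    then show "u \<in> symbol ` alg_B l"
      using symbol_code_op[OF F(1)] alg_BI[OF F(1)] by (metis imageI)
  qed
  ultimately show ?thesis
    unfolding star_iso_cfunctions_def bij_betw_def
    by (auto elim!: alg_BE simp: code_op_add code_op_scale code_op_comp code_op_adj symbol_apply
        continuous_on_add continuous_on_mult continuous_on_cnj continuous_on_const)
qed

text \<open>The spectrum of \<open>C(K)\<close>, \<open>K\<close> compact: were no point of \<open>K\<close> to represent \<open>\<phi>\<close>, a finite sum
  of \<open>cnj G * G\<close> with \<open>\<phi> G = 0\<close> would be invertible, yet annihilated by \<open>\<phi>\<close>.\<close>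

lemma character_alg_B:
  assumes \<phi>: "character (alg_B l) \<phi>"
  obtains y where "y \<in> code_space" "\<And>F. continuous_on code_space F \<Longrightarrow> \<phi> (code_op F) = F y"
proof -
  have \<phi>_add: "\<phi> (code_op (\<lambda>y. F y + G y)) = \<phi> (code_op F) + \<phi> (code_op G)"
    and \<phi>_mult: "\<phi> (code_op (\<lambda>y. F y * G y)) = \<phi> (code_op F) * \<phi> (code_op G)"
    if "continuous_on code_space F" "continuous_on code_space G" for F G
    using \<phi> alg_BI[OF that(1)] alg_BI[OF that(2)] code_op_add[OF that, symmetric]
      code_op_comp[OF that, symmetric] by (auto simp: character_def)
  have \<phi>_scale: "\<phi> (code_op (\<lambda>y. c * F y)) = c * \<phi> (code_op F)"
    if "continuous_on code_space F" for F c
    using \<phi> alg_BI[OF that] code_op_scale[OF that, of c, symmetric] by (auto simp: character_def)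
  obtain a where "a \<in> alg_B l" "\<phi> a \<noteq> 0" using \<phi> by (auto simp: character_def)
  then obtain A where "continuous_on code_space A" "\<phi> (code_op A) \<noteq> 0" by (auto elim!: alg_BE)
  then have \<phi>_1: "\<phi> (code_op (\<lambda>_. 1)) = 1" using \<phi>_mult[of A "\<lambda>_. 1"] by simp
  have \<phi>_const: "\<phi> (code_op (\<lambda>_. c)) = c" for c
    using \<phi>_scale[of "\<lambda>_. 1" c] by (simp add: \<phi>_1)
  have "\<exists>y\<in>code_space. \<forall>F. continuous_on code_space F \<longrightarrow> \<phi> (code_op F) = F y"
  proof (rule ccontr)
    assume "\<not> ?thesis"
    then obtain G where G: "\<And>y. y \<in> code_space \<Longrightarrow> continuous_on code_space (G y)"
        "\<And>y. y \<in> code_space \<Longrightarrow> \<phi> (code_op (G y)) \<noteq> G y y" by metis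
    \<comment> \<open>Centring puts \<open>G y\<close> minus its \<phi>-value in the kernel of
      \<phi> without making it vanish at \<open>y\<close>; the conjugate factor makes
      \<open>H\<close> nonnegative, so that sums cannot cancel. \<phi> is not assumed to respect
      adjoints: multiplicativity alone annihilates the product.\<close>
    define H where "H y z = cnj (G y z - \<phi> (code_op (G y))) * (G y z - \<phi> (code_op (G y)))" for y z
    have cH: "continuous_on code_space (H y)" if "y \<in> code_space" for y
      unfolding H_def using G(1)[OF that] by (intro continuous_intros)
    have \<phi>H: "\<phi> (code_op (H y)) = 0" if y: "y \<in> code_space" for y
    proof -
      let ?D = "\<lambda>z. G y z + - \<phi> (code_op (G y))"
      have cD: "continuous_on code_space ?D" using G(1)[OF y] by (intro continuous_intros)
      have "\<phi> (code_op ?D) = 0"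
        by (simp only: \<phi>_add[OF G(1)[OF y] continuous_on_const] \<phi>_const right_minus)
      moreover have "continuous_on code_space (\<lambda>z. cnj (?D z))"
        using cD by (rule continuous_on_cnj)
      ultimately have "\<phi> (code_op (\<lambda>z. cnj (?D z) * ?D z)) = 0"
        using \<phi>_mult[of "\<lambda>z. cnj (?D z)" ?D] cD by simp
      then show ?thesis by (simp add: H_def[abs_def])
    qed
    have H_nonneg: "H y z = complex_of_real ((cmod (G y z - \<phi> (code_op (G y))))\<^sup>2)" for y z
      unfolding H_def by (simp only: mult.commute[of "cnj _"] complex_norm_square[symmetric] of_real_power)
    have "\<exists>W. open W \<and> W \<inter> code_space = (\<lambda>z. H y z) -` (- {0}) \<inter> code_space" if "y \<in> code_space" for y
      using cH[OF that] open_Compl[OF closed_singleton[of 0]] unfolding continuous_on_open_invariant by blast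
    then obtain W where W: "\<And>y. y \<in> code_space \<Longrightarrow> open (W y)"
        "\<And>y. y \<in> code_space \<Longrightarrow> W y \<inter> code_space = (\<lambda>z. H y z) -` (- {0}) \<inter> code_space" by metis
    have "y \<in> W y" if y: "y \<in> code_space" for y
    proof -
      have "H y y \<noteq> 0" unfolding H_nonneg using G(2)[OF y] by simp
      then show ?thesis using W(2)[OF y] y by blast
    qed
    then have cover: "code_space \<subseteq> (\<Union>y\<in>code_space. W y)" by blast
    obtain C where C: "C \<subseteq> code_space" "finite C" "code_space \<subseteq> (\<Union>y\<in>C. W y)"
      by (rule compactE_image[OF compact_code_space _ cover]) (use W in auto)
    define S where "S z = (\<Sum>y\<in>C. H y z)" for z
    have cS: "continuous_on code_space S"
      unfolding S_def using C(1) by (intro continuous_on_sum cH) auto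
    have "\<phi> (code_op (\<lambda>z. \<Sum>y\<in>C. H y z)) = 0"
      using C(2,1)
    proof (induction C)
      case empty
      then show ?case using \<phi>_scale[of "\<lambda>_. 1" 0] by simp
    next
      case (insert y C)
      then have "continuous_on code_space (\<lambda>z. \<Sum>y\<in>C. H y z)" by (intro continuous_on_sum cH) auto
      then show ?case using insert \<phi>_add[OF cH[of y], of "\<lambda>z. \<Sum>y\<in>C. H y z"] \<phi>H[of y] by simp
    qed
    then have \<phi>S: "\<phi> (code_op S) = 0" by (simp add: S_def[abs_def])
    have S0: "S z \<noteq> 0" if z: "z \<in> code_space" for z
    proof -
      obtain y where y: "y \<in> C" "z \<in> W y" using C(3) z by blast
      then have "H y z \<noteq> 0" using W(2)[of y] C(1) z by blast
      then have "0 < (cmod (G y z - \<phi> (code_op (G y))))\<^sup>2" unfolding H_nonneg by simp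
      then have "0 < (\<Sum>y\<in>C. (cmod (G y z - \<phi> (code_op (G y))))\<^sup>2)"
        by (intro sum_pos2[OF C(2) y(1)]) auto
      then show ?thesis unfolding S_def H_nonneg by (simp flip: of_real_sum of_real_power)
    qed
    have "continuous_on code_space (\<lambda>z. inverse (S z))"
      using cS S0 by (intro continuous_on_inverse) auto
    from \<phi>_mult[OF cS this] have "\<phi> (code_op (\<lambda>z. S z * inverse (S z))) = 0" by (simp add: \<phi>S)
    moreover have "code_op (\<lambda>z. S z * inverse (S z)) = code_op (\<lambda>_. 1)"
      by (rule code_op_cong) (simp add: S0)
    ultimately show False by (simp add: \<phi>_1)
  qed
  then show thesis using that by blast
qed

section \<open>The spectrum and the map generated on it\<close>

lemma eval_at_character:
  assumes x: "x \<in> topspace (ext_M l)" shows "character (alg_B l) (eval_at (alg_B l) symbol x)"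
proof -
  have "eval_at (alg_B l) symbol x (code_op F) = F (encode x)" if "continuous_on code_space F" for F
    using alg_BI[OF that] symbol_apply[OF that x] by (simp add: eval_at_def)
  then show ?thesis
    unfolding character_def
    by (auto elim!: alg_BE simp: code_op_add code_op_scale code_op_comp
        continuous_on_add continuous_on_mult continuous_on_const
        intro!: bexI[of _ "code_op (\<lambda>_. 1)"] alg_BI) (simp add: eval_at_def)
qed

text \<open>A continuous bijection from a compact space to a Hausdorff space. Surjectivity is
  \<open>character_alg_B\<close>; injectivity holds because the encoded coordinates are themselves
  symbols.\<close>

lemma eval_at_homeomorphic_map:
  "homeomorphic_map (ext_M l) (spectrum (alg_B l)) (eval_at (alg_B l) symbol)"
proof (rule continuous_imp_homeomorphic_map)
  show "compact_space (ext_M l)"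
    using homeomorphic_compact_space[of "ext_M l" "top_of_set code_space"] encode_homeomorphic_maps
      compact_code_space
    by (auto simp: homeomorphic_space_def compact_space_subtopology)
  show "Hausdorff_space (spectrum (alg_B l))"
    unfolding spectrum_def
    by (intro Hausdorff_space_subtopology) (simp add: Hausdorff_space_product_topology)
  have "continuous_map (ext_M l) (product_topology (\<lambda>_. euclidean) (alg_B l)) (eval_at (alg_B l) symbol)"
    unfolding continuous_map_componentwise
  proof (intro conjI ballI)
    show "eval_at (alg_B l) symbol ` topspace (ext_M l) \<subseteq> extensional (alg_B l)"
      by (auto simp: eval_at_def)
    fix b assume b: "b \<in> alg_B l"
    then have "symbol b \<in> cfunctions (ext_M l)"
      using symbol_star_iso unfolding star_iso_cfunctions_def by (metis bij_betwE)
    then show "continuous_map (ext_M l) euclidean (\<lambda>x. eval_at (alg_B l) symbol x b)"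
      using b by (simp add: eval_at_def cfunctions_def)
  qed
  then show "continuous_map (ext_M l) (spectrum (alg_B l)) (eval_at (alg_B l) symbol)"
    unfolding spectrum_def continuous_map_in_subtopology using eval_at_character by blast
  show "eval_at (alg_B l) symbol ` topspace (ext_M l) = topspace (spectrum (alg_B l))"
  proof
    show "eval_at (alg_B l) symbol ` topspace (ext_M l) \<subseteq> topspace (spectrum (alg_B l))"
      by (auto simp: spectrum_def eval_at_character) (simp add: eval_at_def)
    show "topspace (spectrum (alg_B l)) \<subseteq> eval_at (alg_B l) symbol ` topspace (ext_M l)"
    proof
      fix \<phi> assume "\<phi> \<in> topspace (spectrum (alg_B l))"
      then have \<phi>: "character (alg_B l) \<phi>" by (simp add: spectrum_def)
      then obtain y where y: "y \<in> code_space" "\<And>F. continuous_on code_space F \<Longrightarrow> \<phi> (code_op F) = F y"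
        by (metis character_alg_B)
      have "\<phi> b = eval_at (alg_B l) symbol (decode y) b" for b
      proof (cases "b \<in> alg_B l")
        case True
        then show ?thesis
          using y by (auto elim!: alg_BE simp: eval_at_def symbol_apply decode_in encode_decode)
      next
        case False
        then show ?thesis using \<phi> by (simp add: eval_at_def character_def extensional_def)
      qed
      then have "\<phi> = eval_at (alg_B l) symbol (decode y)" by (rule ext)
      then show "\<phi> \<in> eval_at (alg_B l) symbol ` topspace (ext_M l)" using decode_in[OF y(1)] by blast
    qed
  qed
  show "inj_on (eval_at (alg_B l) symbol) (topspace (ext_M l))"
  proof (rule inj_onI)
    fix x x' assume x: "x \<in> topspace (ext_M l)" "x' \<in> topspace (ext_M l)"
      and eq: "eval_at (alg_B l) symbol x = eval_at (alg_B l) symbol x'"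
    have "encode x n = encode x' n" for n
    proof -
      have c: "continuous_on code_space (\<lambda>y. complex_of_real (y n))"
        by (intro continuous_intros continuous_on_subset[OF continuous_on_product_coordinates]) simp
      have "symbol (code_op (\<lambda>y. complex_of_real (y n))) x = symbol (code_op (\<lambda>y. complex_of_real (y n))) x'"
        using fun_cong[OF eq, of "code_op (\<lambda>y. complex_of_real (y n))"] alg_BI[OF c]
        by (simp add: eval_at_def)
      then show ?thesis using symbol_apply[OF c] x by simp
    qed
    then have "encode x = encode x'" by (rule ext)
    then show "x = x'" using decode_encode x by metis
  qed
qed

lemma symbol_conj_by:
  assumes "b \<in> alg_B l" "x \<in> topspace (ext_M l)"
  shows "symbol (conj_by (U_op l) b) x = symbol b (ext_alpha l x)"
  using assms
  by (auto elim!: alg_BE simp: code_op_conj symbol_apply continuous_on_comp_cons encode_ext_alpha ext_alpha_in)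

lemma generated_map_eval_at:
  assumes "x \<in> topspace (ext_M l)"
  shows "generated_map (U_op l) (alg_B l) (eval_at (alg_B l) symbol x) =
    eval_at (alg_B l) symbol (ext_alpha l x)"
  using symbol_conj_by[OF _ assms] conj_by_in_alg_B
  by (auto simp: generated_map_def eval_at_def restrict_def fun_eq_iff)

end

theorem theorem3p2:
  fixes l :: real
  assumes "0 < l" and "l \<le> 1"
  shows "homeomorphic_map (ext_M l)
           (subtopology (ext_M l) (ext_alpha l ` topspace (ext_M l))) (ext_alpha l) \<and>
         partial_automorphism (alg_B l) (conj_by (U_op l)) \<and>
         generates_on (U_op l) (alg_B l) \<and>
         (\<exists>\<Phi>. star_iso_cfunctions (alg_B l) (ext_M l) \<Phi> \<and>
           (\<forall>b\<in>alg_B l. \<forall>x\<in>topspace (ext_M l).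
              \<Phi> (conj_by (U_op l) b) x = \<Phi> b (ext_alpha l x)) \<and>
           homeomorphic_map (ext_M l) (spectrum (alg_B l)) (eval_at (alg_B l) \<Phi>) \<and>
           (\<forall>x\<in>topspace (ext_M l).
              generated_map (U_op l) (alg_B l) (eval_at (alg_B l) \<Phi> x) =
              eval_at (alg_B l) \<Phi> (ext_alpha l x)))"
proof -
  interpret logistic_parameter l using assms by unfold_locales
  show ?thesis
    using ext_alpha_homeomorphic_map alg_B_partial_automorphism alg_B_generates symbol_star_iso
      symbol_conj_by eval_at_homeomorphic_map generated_map_eval_at by blast
qed

end
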